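(* Let $3\le r\le t$ and $k>r$ be integers, and write $h=bt+p$ with integers $b\ge 0$ and $0\le p<t$. Put $\gamma_p=p\Bigl(\binom{p-1}{r-1}\big/\binom{t-1}{r-1}\Bigr)^{\sigma_r}$ if $p\ge r$ and $\gamma_p=0$ otherwise. Every graph $F$ of order $h$ with maximum degree $\Delta(F)\le t-1$ satisfies $$\mathcal E_r(F)\le bt+\gamma_p .$$ If $p\ge r$, equality holds if and only if $F\cong bK_t\cup K_p$; if $p<r$, equality holds if and only if $F\cong bK_t\cup F_0$ for some graph $F_0$ of order $p$.
   Context: All graphs are simple and finite; $\cup$ is disjoint union and $bK_t$ is the disjoint union of $b$ copies of $K_t$. For a graph $F$, an integer $1\le r<k$ and a nonnegative vector $z$ on $V(F)$, put $$S_r(F,z)=\sum_{Q}\prod_{v\in Q}z_v,$$ the sum being over all $r$-cliques $Q$ of $F$, and $$L_r(F)=\max\Bigl\{S_r(F,z):z\ge0,\ \sum_{v\in V(F)}z_v^k=1\Bigr\},$$ with $L_r(F)=0$ when $V(F)=\emptyset$. Put $\sigma_r=\frac{k}{k-r}$, $C_r=\frac1t\binom tr$ and define the capacity $\mathcal E_r(F)=\bigl(L_r(F)/C_r\bigr)^{\sigma_r}$ (it depends on the fixed integers $k$ and $t$). *)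

theory Defs
  imports "HOL-Analysis.Analysis" "HOL-Library.Ramsey"
begin

datatype 'a ugraph = Graph (verts: "'a set") (edges: "'a set set")

definition simple_graph :: "'a ugraph \<Rightarrow> bool" where
  "simple_graph G \<longleftrightarrow> finite (verts G) \<and> edges G \<subseteq> [verts G]\<^bsup>2\<^esup>"

definition degree :: "'a ugraph \<Rightarrow> 'a \<Rightarrow> nat" where
  "degree G v = card {w \<in> verts G. {v, w} \<in> edges G}"

text \<open>The inserted \<open>0\<close> fixes the maximum degree of the graph without vertices.\<close>

definition max_degree :: "'a ugraph \<Rightarrow> nat" where
  "max_degree G = Max (insert 0 (degree G ` verts G))"

definition graph_iso :: "'a ugraph \<Rightarrow> 'b ugraph \<Rightarrow> bool" (infix \<open>\<cong>\<^sub>g\<close> 50) where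
  "G \<cong>\<^sub>g H \<longleftrightarrow> (\<exists>f. bij_betw f (verts G) (verts H) \<and>
     (\<forall>u\<in>verts G. \<forall>v\<in>verts G. {u, v} \<in> edges G \<longleftrightarrow> {f u, f v} \<in> edges H))"

definition complete_graph :: "nat \<Rightarrow> nat ugraph" where
  "complete_graph n = Graph {..<n} ([{..<n}]\<^bsup>2\<^esup>)"

definition disj_union :: "'a ugraph \<Rightarrow> 'b ugraph \<Rightarrow> ('a + 'b) ugraph" (infixr \<open>\<union>\<^sub>g\<close> 65) where
  "G \<union>\<^sub>g H = Graph (verts G <+> verts H) ((`) Inl ` edges G \<union> (`) Inr ` edges H)"

definition copies :: "nat \<Rightarrow> 'a ugraph \<Rightarrow> (nat \<times> 'a) ugraph" where
  "copies b G = Graph ({..<b} \<times> verts G) {Pair i ` e | i e. i < b \<and> e \<in> edges G}"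

definition cliques :: "nat \<Rightarrow> 'a ugraph \<Rightarrow> 'a set set" where
  "cliques r G = {Q \<in> [verts G]\<^bsup>r\<^esup>. clique Q (edges G)}"

definition clique_sum :: "nat \<Rightarrow> 'a ugraph \<Rightarrow> ('a \<Rightarrow> real) \<Rightarrow> real" where
  "clique_sum r G z = (\<Sum>Q\<in>cliques r G. \<Prod>v\<in>Q. z v)"

text \<open>A vector on the vertices is a function on the whole vertex type; its values outside
  the vertex set are irrelevant.\<close>

definition unit_vectors :: "nat \<Rightarrow> 'a ugraph \<Rightarrow> ('a \<Rightarrow> real) set" where
  "unit_vectors k G = {z. (\<forall>v\<in>verts G. 0 \<le> z v) \<and> (\<Sum>v\<in>verts G. z v ^ k) = 1}"

text \<open>The supremum is a maximum, see \<open>clique_lagrangian_attained\<close> below.\<close>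

definition clique_lagrangian :: "nat \<Rightarrow> nat \<Rightarrow> 'a ugraph \<Rightarrow> real" where
  "clique_lagrangian k r G =
     (if verts G = {} then 0 else SUP z\<in>unit_vectors k G. clique_sum r G z)"

definition \<sigma> :: "nat \<Rightarrow> nat \<Rightarrow> real" where
  "\<sigma> k r = real k / (real k - real r)"

definition capacity :: "nat \<Rightarrow> nat \<Rightarrow> nat \<Rightarrow> 'a ugraph \<Rightarrow> real" where
  "capacity k t r G = (clique_lagrangian k r G / (1 / real t * real (t choose r))) powr \<sigma> k r"

definition \<gamma> :: "nat \<Rightarrow> nat \<Rightarrow> nat \<Rightarrow> nat \<Rightarrow> real" where
  "\<gamma> k t r p =
     (if r \<le> p then real p * (real ((p - 1) choose (r - 1)) / real ((t - 1) choose (r - 1))) powr \<sigma> k r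
      else 0)"

lemma clique_lagrangian_attained:
  assumes fin: "finite (verts G)" and ne: "verts G \<noteq> {}" and k: "0 < k"
  shows "\<exists>z\<in>unit_vectors k G. clique_sum r G z = clique_lagrangian k r G \<and>
           (\<forall>w\<in>unit_vectors k G. clique_sum r G w \<le> clique_sum r G z)"
proof -
  let ?V = "verts G"
  define K :: "('a \<Rightarrow> real) set"
    where "K = PiE UNIV (\<lambda>v. if v \<in> ?V then {0..1} else {0})"
  define U where "U = {z \<in> K. (\<Sum>v\<in>?V. z v ^ k) = 1}"
  have "compactin (product_topology (\<lambda>_. euclidean) UNIV) K"
    unfolding K_def by (subst compactin_PiE) simp
  then have cK: "compact K"
    by (simp add: euclidean_product_topology)
  have cont: "continuous_on A (\<lambda>z::'a \<Rightarrow> real. z v)" for v A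
    by (rule continuous_on_subset[OF continuous_on_product_coordinates]) simp
  have "closed {z :: 'a \<Rightarrow> real. (\<Sum>v\<in>?V. z v ^ k) = 1}"
  proof -
    have "continuous_on UNIV (\<lambda>z::'a \<Rightarrow> real. \<Sum>v\<in>?V. z v ^ k)"
      by (intro continuous_on_sum continuous_on_power cont)
    then show ?thesis by (rule closed_Collect_eq) (rule continuous_on_const)
  qed
  then have "compact (K \<inter> {z. (\<Sum>v\<in>?V. z v ^ k) = 1})"
    by (rule compact_Int_closed[OF cK])
  moreover have "K \<inter> {z. (\<Sum>v\<in>?V. z v ^ k) = 1} = U"
    unfolding U_def by blast
  ultimately have cU: "compact U" by simp
  obtain a where a: "a \<in> ?V" using ne by auto
  have "(\<Sum>v\<in>?V. (if v = a then 1 else 0 :: real) ^ k) = (\<Sum>v\<in>?V. if v = a then 1 else 0)"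
    using k by (intro sum.cong) auto
  then have "(\<lambda>v. if v = a then 1 else 0) \<in> U"
    using a fin k by (auto simp: U_def K_def)
  then have "U \<noteq> {}" by blast
  moreover have "continuous_on U (clique_sum r G)"
    unfolding clique_sum_def by (intro continuous_on_sum continuous_on_prod cont)
  ultimately obtain z where z: "z \<in> U" "\<And>w. w \<in> U \<Longrightarrow> clique_sum r G w \<le> clique_sum r G z"
    using continuous_attains_sup[OF cU] by blast
  have zU: "z \<in> unit_vectors k G"
  proof -
    have "0 \<le> z v" if "v \<in> ?V" for v
    proof -
      have "z v \<in> (if v \<in> ?V then {0..1} else {0})"
        using z(1) unfolding U_def K_def by (blast dest: PiE_mem)
      then show ?thesis using that by simp
    qed
    then show ?thesis using z(1) by (auto simp: U_def unit_vectors_def)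
  qed
  have max: "clique_sum r G w \<le> clique_sum r G z" if w: "w \<in> unit_vectors k G" for w
  proof -
    let ?w = "\<lambda>v. if v \<in> ?V then w v else 0"
    have "w v \<le> 1" if v: "v \<in> ?V" for v
    proof -
      have "w v ^ k \<le> (\<Sum>v\<in>?V. w v ^ k)"
        using w v fin by (intro member_le_sum) (auto simp: unit_vectors_def)
      then have "w v ^ k \<le> 1" using w by (simp add: unit_vectors_def)
      then show ?thesis
        using one_less_power[OF _ k, of "w v"] by (meson linorder_not_le)
    qed
    then have "?w \<in> U"
      using w by (auto simp: U_def K_def unit_vectors_def)
    moreover have "clique_sum r G ?w = clique_sum r G w"
      unfolding clique_sum_def cliques_def nsets_def
      by (intro sum.cong prod.cong refl) auto
    ultimately show ?thesis using z(2) by metis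
  qed
  have "(SUP w\<in>unit_vectors k G. clique_sum r G w) = clique_sum r G z"
    using zU max by (intro cSup_eq_maximum) auto
  then show ?thesis using zU max ne by (auto simp: clique_lagrangian_def)
qed

end

theory Submission
  imports Defs
begin

text \<open>Scaling turns the constrained maximum into an unconstrained one: with
  \<open>D = (t - 1) choose (r - 1)\<close>, the capacity of \<open>F\<close> times \<open>1 - r/k\<close> is the maximum over \<open>z \<ge> 0\<close> of
  \<open>\<Psi>\<^sub>F(z) = (r/D) S\<^sub>r(F, z) - (r/k) \<Sum>\<^sub>v z\<^sub>v\<^sup>k\<close>, which is additive over disjoint unions. On a complete graph
  of order \<open>m\<close>, the AM-GM inequality splits \<open>\<Psi>\<close> into one-variable problems and gives
  \<open>\<Psi> \<le> (1 - r/k) \<gamma>\<^sub>m\<close>.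

  For general \<open>F\<close>, a double count over sets of \<open>r + 1\<close> vertices (Chase, Chao and Dong), in which the
  vertex \<open>v\<close> gets the weight \<open>z\<^sub>v\<close>, yields a vertex \<open>v\<close> with \<open>z\<^sub>v > 0\<close> such that the cliques meeting the
  closed neighbourhood \<open>N[v]\<close> weigh at most as much as all \<open>r\<close>-subsets of \<open>N[v]\<close>. Hence
  \<open>\<Psi>\<^sub>F(z)\<close> is at most the value of \<open>F - N[v]\<close> plus that of a complete graph on \<open>N[v]\<close>, and the bound
  follows by induction, because \<open>bt + p \<mapsto> bt + \<gamma>\<^sub>p\<close> is superadditive by discrete convexity of \<open>\<gamma>\<close>.
  In the case of equality every vertex of the support of \<open>z\<close> has these properties with equality, which
  forces its closed neighbourhood to be a complete component.\<close>

section \<open>Inequality of arithmetic and geometric means\<close>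

text \<open>Weighted AM-GM for \<open>r\<close> terms \<open>x ^ (r + n)\<close> and
  \<open>n\<close> terms \<open>s ^ (r + n)\<close>, by induction on \<open>n\<close>. The gap
  satisfies \<Delta> (n + 1) = s \<Delta> n + R n, and \<open>R n\<close> is a sum of products of
  powers of \<open>x\<close> with factors (x - s)(x^m - s^m), which are nonnegative because both
  differences have the same sign.\<close>

lemma two_term_AM_GM:
  fixes x s :: real
  assumes "0 \<le> x" "0 \<le> s"
  shows "real (r + n) * s ^ n * x ^ r \<le> real r * x ^ (r + n) + real n * s ^ (r + n)"
    and "x \<noteq> s \<Longrightarrow> 0 < r \<Longrightarrow> 0 < n \<Longrightarrow>
      real (r + n) * s ^ n * x ^ r < real r * x ^ (r + n) + real n * s ^ (r + n)"
proof -
  define \<Delta> where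
    "\<Delta> n = real r * x ^ (r + n) + real n * s ^ (r + n) - real (r + n) * s ^ n * x ^ r" for n
  define R where
    "R n = (\<Sum>i<r. x ^ (r - Suc i) * ((x - s) * (x ^ Suc (n + i) - s ^ Suc (n + i))))" for n
  have step: "\<Delta> (Suc n) = s * \<Delta> n + R n" for n
  proof -
    have "R n = (x - s) * (\<Sum>i<r. x ^ (r + n) - s ^ Suc n * (x ^ (r - Suc i) * s ^ i))"
      unfolding R_def sum_distrib_left
    proof (rule sum.cong[OF refl])
      fix i assume "i \<in> {..<r}"
      then have "x ^ (r - Suc i) * x ^ Suc (n + i) = x ^ (r + n)"
        by (simp flip: power_add power_Suc)
      moreover have "x ^ (r - Suc i) * ((x - s) * (X - s ^ Suc (n + i)))
          = (x - s) * (x ^ (r - Suc i) * X - s ^ Suc n * (x ^ (r - Suc i) * s ^ i))" for X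
        by (simp add: algebra_simps power_add)
      ultimately show "x ^ (r - Suc i) * ((x - s) * (x ^ Suc (n + i) - s ^ Suc (n + i)))
          = (x - s) * (x ^ (r + n) - s ^ Suc n * (x ^ (r - Suc i) * s ^ i))"
        by (simp only:)
    qed
    also have "\<dots> = (x - s) * (real r * x ^ (r + n))
        - s ^ Suc n * ((x - s) * (\<Sum>i<r. x ^ (r - Suc i) * s ^ i))"
      by (simp add: sum_subtractf sum_distrib_left right_diff_distrib mult_ac)
    also have "(x - s) * (\<Sum>i<r. x ^ (r - Suc i) * s ^ i) = x ^ r - s ^ r"
      using power_diff_sumr2[of s r x] by (simp add: algebra_simps)
    finally show ?thesis
      by (simp add: \<Delta>_def algebra_simps power_add)
  qed
  have "0 \<le> (x - s) * (x ^ Suc m - s ^ Suc m)" for m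
    using assms by (cases "x \<le> s") (auto intro!: mult_nonneg_nonneg mult_nonpos_nonpos power_mono simp del: power_Suc)
  then have R: "0 \<le> R n" for n
    unfolding R_def by (intro sum_nonneg mult_nonneg_nonneg[OF zero_le_power] assms(1)) blast
  have nonneg: "0 \<le> \<Delta> n" for n
    by (induction n) (use assms R in \<open>auto simp: step \<Delta>_def[of 0]\<close>)
  then show "real (r + n) * s ^ n * x ^ r \<le> real r * x ^ (r + n) + real n * s ^ (r + n)"
    by (simp add: \<Delta>_def)
  assume neq: "x \<noteq> s" and "0 < r" "0 < n"
  then obtain n' where n': "n = Suc n'"
    using gr0_implies_Suc by blast
  have pos: "0 < (x - s) * (x ^ Suc m - s ^ Suc m)" for m
    using assms neq power_strict_mono[of x s "Suc m"] power_strict_mono[of s x "Suc m"]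
    by (cases "x < s") (auto simp: zero_less_mult_iff simp del: power_Suc)
  have "0 < R n'"
    unfolding R_def
  \<comment> \<open>In the summand with index \<open>r - 1\<close> the power of \<open>x\<close> has
    exponent 0, so this summand is positive even for \<open>x = 0\<close>.\<close>
  proof (rule sum_pos2[of _ "r - 1"])
    show "0 < x ^ (r - Suc (r - 1)) * ((x - s) * (x ^ Suc (n' + (r - 1)) - s ^ Suc (n' + (r - 1))))"
      using pos[of "n' + (r - 1)"] \<open>0 < r\<close> by (simp del: power_Suc)
    show "0 \<le> x ^ (r - Suc i) * ((x - s) * (x ^ Suc (n' + i) - s ^ Suc (n' + i)))" for i
      using assms(1) less_imp_le[OF pos] by (intro mult_nonneg_nonneg[OF zero_le_power])
  qed (use \<open>0 < r\<close> in auto)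
  then have "0 < \<Delta> n"
    using nonneg[of n'] assms by (simp add: n' step add_nonneg_pos)
  then show "real (r + n) * s ^ n * x ^ r < real r * x ^ (r + n) + real n * s ^ (r + n)"
    by (simp add: \<Delta>_def)
qed

lemma power_powr_sigma:
  fixes a :: real
  assumes "0 \<le> a" "r < k"
  defines "s \<equiv> a powr (1 / real (k - r))"
  shows "s ^ (k - r) = a" "s ^ k = a powr \<sigma> k r" "0 \<le> s"
proof -
  show "0 \<le> s" by (simp add: s_def)
  show "s ^ (k - r) = a" 
    using assms by (cases "a = 0") (auto simp: s_def powr_realpow[symmetric] powr_powr)
  show "s ^ k = a powr \<sigma> k r"
    using assms by (cases "a = 0") (auto simp: s_def powr_realpow[symmetric] powr_powr \<sigma>_def of_nat_diff)
qed

text \<open>The derivative in \<open>x\<close> vanishes where \<open>x ^ (k - r) = a\<close>, that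
  is at \<open>s = a powr (1 / real (k - r))\<close>. Substituting \<open>a = s ^ (k - r)\<close>
  turns the difference of the two sides into 1/k times the gap of \<open>two_term_AM_GM\<close> with
  \<open>n = k - r\<close>, so \<open>s\<close> is the unique maximiser when
  \<open>0 < r\<close>.\<close>

lemma scalar_bound:
  fixes a x :: real
  assumes "0 \<le> a" "0 \<le> x" "r < k"
  shows "a * x ^ r - real r / real k * x ^ k \<le> (1 - real r / real k) * a powr \<sigma> k r"
    and "0 < r \<Longrightarrow> a * x ^ r - real r / real k * x ^ k = (1 - real r / real k) * a powr \<sigma> k r
      \<longleftrightarrow> x = a powr (1 / real (k - r))"
proof -
  define s where "s = a powr (1 / real (k - r))"
  note s = power_powr_sigma[OF assms(1,3), folded s_def]
  have k: "r + (k - r) = k" "0 < k" using assms by auto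
  have gap: "(1 - real r / real k) * a powr \<sigma> k r - (a * x ^ r - real r / real k * x ^ k)
      = (real r * x ^ k + real (k - r) * s ^ k - real k * s ^ (k - r) * x ^ r) / real k"
    using k assms s by (simp add: field_simps of_nat_diff)
  show "a * x ^ r - real r / real k * x ^ k \<le> (1 - real r / real k) * a powr \<sigma> k r"
    using two_term_AM_GM(1)[OF assms(2) s(3), of r "k - r"] k gap
    by (smt (verit, best) divide_nonneg_nonneg of_nat_0_le_iff)
  assume "0 < r"
  have "a * x ^ r - real r / real k * x ^ k = (1 - real r / real k) * a powr \<sigma> k r" if "x = s"
  proof -
    have "s ^ (k - r) * x ^ r = s ^ k"
      using that k by (simp flip: power_add)
    then have "a * x ^ r = s ^ k" using s(1) by simp
    then show ?thesis using s(2) that by (simp add: left_diff_distrib)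
  qed
  moreover have "x = s" if "a * x ^ r - real r / real k * x ^ k = (1 - real r / real k) * a powr \<sigma> k r"
  proof (rule ccontr)
    assume "x \<noteq> s"
    from two_term_AM_GM(2)[OF assms(2) s(3) this \<open>0 < r\<close>, of "k - r"] assms(3) k gap that
    show False by (auto simp: divide_eq_0_iff)
  qed
  ultimately show "a * x ^ r - real r / real k * x ^ k = (1 - real r / real k) * a powr \<sigma> k r
      \<longleftrightarrow> x = a powr (1 / real (k - r))"
    unfolding s_def by blast
qed

section \<open>Sums over all \<open>r\<close>-subsets of a set\<close>

lemma prod_le_sum_power:
  fixes z :: "'a \<Rightarrow> real"
  assumes "finite A" "card A = r" "0 < r" "\<And>v. v \<in> A \<Longrightarrow> 0 \<le> z v"
  shows "real r * (\<Prod>v\<in>A. z v) \<le> (\<Sum>v\<in>A. z v ^ r)"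
proof -
  have A: "A \<noteq> {}" using assms by auto
  have "(\<Prod>v\<in>A. z v ^ r) powr (1 / real r) = (\<Prod>v\<in>A. z v)"
  proof -
    have "0 \<le> (\<Prod>v\<in>A. z v)" using assms by (intro prod_nonneg) auto
    then have "((\<Prod>v\<in>A. z v) ^ r) powr (1 / real r) = (\<Prod>v\<in>A. z v)"
      using \<open>0 < r\<close> by (cases "(\<Prod>v\<in>A. z v) = 0") (auto simp: powr_realpow[symmetric] powr_powr)
    then show ?thesis by (simp add: prod_power_distrib)
  qed
  with arith_geom_mean[OF \<open>finite A\<close> A, of "\<lambda>v. z v ^ r"] assms
  have "(\<Prod>v\<in>A. z v) \<le> (\<Sum>v\<in>A. z v ^ r / real r)" by simp
  then show ?thesis
    using \<open>0 < r\<close> by (simp add: field_simps flip: sum_divide_distrib)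
qed

lemma card_nsets_containing:
  assumes "finite N" "u \<in> N" "0 < r"
  shows "card {A \<in> [N]\<^bsup>r\<^esup>. u \<in> A} = (card N - 1) choose (r - 1)"
proof -
  have "bij_betw (insert u) ([N - {u}]\<^bsup>(r - 1)\<^esup>) {A \<in> [N]\<^bsup>r\<^esup>. u \<in> A}"
    by (rule bij_betw_byWitness[where f' = "\<lambda>A. A - {u}"])
      (use assms in \<open>auto simp: nsets_def insert_absorb card_insert_if\<close>)
  then show ?thesis
    using bij_betw_same_card assms by (fastforce simp: card_nsets)
qed

text \<open>AM-GM is applied to each \<open>r\<close>-subset; after exchanging the sums, each vertex
  is counted once for every \<open>r\<close>-subset containing it. The right side is a sum of
  one-variable terms, and constant vectors lose nothing.\<close>

lemma nsets_prod_sum_le: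
  fixes z :: "'a \<Rightarrow> real"
  assumes "finite N" "0 < r" "\<And>v. v \<in> N \<Longrightarrow> 0 \<le> z v"
  shows "real r * (\<Sum>A\<in>[N]\<^bsup>r\<^esup>. \<Prod>v\<in>A. z v)
    \<le> real ((card N - 1) choose (r - 1)) * (\<Sum>v\<in>N. z v ^ r)"
proof -
  have fin: "finite ([N]\<^bsup>r\<^esup>)" using assms by (simp add: finite_imp_finite_nsets)
  have "real r * (\<Sum>A\<in>[N]\<^bsup>r\<^esup>. \<Prod>v\<in>A. z v) \<le> (\<Sum>A\<in>[N]\<^bsup>r\<^esup>. \<Sum>v\<in>A. z v ^ r)"
    unfolding sum_distrib_left using assms
    by (intro sum_mono prod_le_sum_power) (auto simp: nsets_def)
  also have "\<dots> = (\<Sum>A\<in>[N]\<^bsup>r\<^esup>. \<Sum>v\<in>{v \<in> N. v \<in> A}. z v ^ r)"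
    by (intro sum.cong) (auto simp: nsets_def)
  also have "\<dots> = (\<Sum>v\<in>N. \<Sum>A\<in>{A \<in> [N]\<^bsup>r\<^esup>. v \<in> A}. z v ^ r)"
    using fin assms by (intro sum.swap_restrict) auto
  also have "\<dots> = (\<Sum>v\<in>N. real ((card N - 1) choose (r - 1)) * z v ^ r)"
    using assms by (intro sum.cong) (auto simp: card_nsets_containing)
  finally show ?thesis by (simp add: sum_distrib_left)
qed

section \<open>Discrete convexity of the remainder term\<close>

text \<open>If one argument is 0, the claim reduces to \<open>2 <= 2 powr p\<close>; for positive
  arguments it is the convexity of the power function.\<close>

lemma powr_midpoint_le:
  fixes x y :: real
  assumes "0 \<le> x" "0 \<le> y" "1 \<le> p"
  shows "2 * ((x + y) / 2) powr p \<le> x powr p + y powr p"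
proof -
  have half: "2 * (c / 2) powr p \<le> c powr p" if "0 \<le> c" for c :: real
  proof -
    have "(2::real) powr 1 \<le> 2 powr p" using assms by (intro powr_mono) auto
    then have "2 * c powr p \<le> 2 powr p * c powr p" by (intro mult_right_mono) auto
    then show ?thesis using that by (simp add: powr_divide field_simps)
  qed
  show ?thesis
  proof (cases "x = 0 \<or> y = 0")
    case True
    then show ?thesis using half[of x] half[of y] assms by auto
  next
    case False
    then show ?thesis
      using convex_onD[OF powr_convex[OF assms(3)], of "1/2" x y] assms
      by (simp add: field_simps)
  qed
qed

lemma sigma_gt_1: "0 < r \<Longrightarrow> r < k \<Longrightarrow> 1 < \<sigma> k r"
  by (simp add: \<sigma>_def)

text \<open>For \<open>0 < q < r\<close> the binomial is 0 and so is its power; for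
  \<open>q = 0\<close> the factor \<open>real q\<close> is 0. This removes the case distinction from
  \<open>\<gamma>\<close>.\<close>

lemma gamma_eq:
  assumes "2 \<le> r"
  shows "\<gamma> k t r q = real q * (real ((q - 1) choose (r - 1)) / real ((t - 1) choose (r - 1))) powr \<sigma> k r"
  using assms by (cases "q = 0") (auto simp: \<gamma>_def binomial_eq_0)

lemma gamma_nonneg: "0 \<le> \<gamma> k t r q"
  by (simp add: \<gamma>_def)

lemma gamma_0 [simp]: "\<gamma> k t r 0 = 0"
  by (simp add: \<gamma>_def)

lemma gamma_full: "0 < r \<Longrightarrow> r \<le> t \<Longrightarrow> \<gamma> k t r t = real t"
  by (simp add: \<gamma>_def)

lemma gamma_pos:
  assumes "0 < r" "r \<le> q" "r \<le> t"
  shows "0 < \<gamma> k t r q"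
  using assms by (auto simp: \<gamma>_def zero_less_binomial_iff intro!: mult_pos_pos)

text \<open>Write \<gamma> at i as i times u i. The second difference at q is q + 1 times the second
  difference of \<open>u\<close> plus \<open>u (q + 2) - u q\<close>. The first term is nonnegative
  because \<open>u\<close> is a convex increasing power of the convex sequence \<open>c\<close>. The
  second is nonnegative by monotonicity, and positive once the binomial at q + 2 is
  positive.\<close>

lemma gamma_second_difference:
  assumes "2 \<le> r" "r \<le> t" "r < k"
  shows "2 * \<gamma> k t r (Suc q) \<le> \<gamma> k t r q + \<gamma> k t r (Suc (Suc q))"
    and "r \<le> Suc (Suc q) \<Longrightarrow> 2 * \<gamma> k t r (Suc q) < \<gamma> k t r q + \<gamma> k t r (Suc (Suc q))"
proof -
  define c where "c i = real ((i - 1) choose (r - 1)) / real ((t - 1) choose (r - 1))" for i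
  define u where "u i = c i powr \<sigma> k r" for i
  have g: "\<gamma> k t r i = real i * u i" for i
    using assms by (simp add: gamma_eq u_def c_def)
  have D: "0 < real ((t - 1) choose (r - 1))" using assms by simp
  have c0: "0 \<le> c i" for i by (simp add: c_def)
  have \<sigma>: "1 < \<sigma> k r" using assms sigma_gt_1 by simp
  have pascal: "Suc m choose (r - 1) = (m choose (r - 2)) + (m choose (r - 1))" for m
    using assms binomial_Suc_Suc[of m "r - 2"] by (simp add: numeral_2_eq_2 Suc_diff_Suc)
  \<comment> \<open>These are the numerators of \<open>c\<close> at q, q + 1 and q + 2. The case
    \<open>q = 0\<close> is separate because \<open>q - 1\<close> is truncated there.\<close>
  have binom: "2 * (q choose (r - 1)) \<le> ((q - 1) choose (r - 1)) + (Suc q choose (r - 1))"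
  proof (cases q)
    case 0 then show ?thesis using pascal[of q] by simp
  next
    case (Suc m)
    have "m choose (r - 2) \<le> Suc m choose (r - 2)" by (simp add: binomial_right_mono)
    then show ?thesis using pascal[of q] pascal[of m] Suc by simp
  qed
  have "2 * c (Suc q) \<le> c q + c (Suc (Suc q))"
  proof -
    have "real (2 * (q choose (r - 1))) \<le> real (((q - 1) choose (r - 1)) + (Suc q choose (r - 1)))"
      using binom by (rule of_nat_mono)
    then show ?thesis using D by (simp add: c_def field_simps)
  qed
  then have "u (Suc q) \<le> ((c q + c (Suc (Suc q))) / 2) powr \<sigma> k r"
    unfolding u_def using c0 \<sigma> by (intro powr_mono2) auto
  then have conv: "2 * u (Suc q) \<le> u q + u (Suc (Suc q))"
    using powr_midpoint_le[OF c0 c0, of "\<sigma> k r" q "Suc (Suc q)"] \<sigma> by (simp add: u_def)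
  have gap: "\<gamma> k t r q + \<gamma> k t r (Suc (Suc q)) - 2 * \<gamma> k t r (Suc q)
      = real (Suc q) * (u q + u (Suc (Suc q)) - 2 * u (Suc q)) + (u (Suc (Suc q)) - u q)"
    by (simp add: g algebra_simps)
  have bm: "(q - 1) choose (r - 1) \<le> q choose (r - 1)" by (simp add: binomial_right_mono)
  then have cm: "c q \<le> c (Suc (Suc q))"
    using pascal[of q] by (simp add: c_def divide_right_mono)
  then have "u q \<le> u (Suc (Suc q))"
    unfolding u_def using c0 \<sigma> by (intro powr_mono2) auto
  moreover have nn: "0 \<le> real (Suc q) * (u q + u (Suc (Suc q)) - 2 * u (Suc q))"
    using conv by (intro mult_nonneg_nonneg) auto
  ultimately show "2 * \<gamma> k t r (Suc q) \<le> \<gamma> k t r q + \<gamma> k t r (Suc (Suc q))"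
    using gap by linarith
  assume "r \<le> Suc (Suc q)"
  then have "0 < q choose (r - 2)" by simp
  then have "(q - 1) choose (r - 1) < Suc q choose (r - 1)" 
    using bm pascal[of q] by linarith
  then have "c q < c (Suc (Suc q))"
    using D by (simp add: c_def divide_strict_right_mono)
  then have "u q < u (Suc (Suc q))"
    unfolding u_def using c0 \<sigma> by (intro powr_less_mono2) auto
  then show "2 * \<gamma> k t r (Suc q) < \<gamma> k t r q + \<gamma> k t r (Suc (Suc q))"
    using gap nn by linarith
qed

text \<open>Both increments telescope into \<open>j\<close> first differences, which are compared
  one by one since first differences of a convex sequence increase.\<close>

lemma gamma_increments:
  assumes "2 \<le> r" "r \<le> t" "r < k" "x \<le> y"
  shows "\<gamma> k t r (x + j) - \<gamma> k t r x \<le> \<gamma> k t r (y + j) - \<gamma> k t r y"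
    and "x < y \<Longrightarrow> 0 < j \<Longrightarrow> r \<le> y + j \<Longrightarrow>
      \<gamma> k t r (x + j) - \<gamma> k t r x < \<gamma> k t r (y + j) - \<gamma> k t r y"
proof -
  define d where "d q = \<gamma> k t r (Suc q) - \<gamma> k t r q" for q
  have step: "d q \<le> d (Suc q)" "r \<le> Suc (Suc q) \<Longrightarrow> d q < d (Suc q)" for q
    using gamma_second_difference[OF assms(1-3), of q] by (auto simp: d_def)
  have mono: "d x \<le> d y" if "x \<le> y" for x y
    using lift_Suc_mono_le[of d, OF step(1) that] .
  have tele: "\<gamma> k t r (x + j) - \<gamma> k t r x = (\<Sum>i<j. d (x + i))" for x j
    using sum_lessThan_telescope[of "\<lambda>i. \<gamma> k t r (x + i)" j] by (simp add: d_def)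
  show "\<gamma> k t r (x + j) - \<gamma> k t r x \<le> \<gamma> k t r (y + j) - \<gamma> k t r y"
    unfolding tele using assms by (intro sum_mono mono) auto
  assume "x < y" "0 < j" "r \<le> y + j"
  then obtain i where j: "j = Suc i" using gr0_implies_Suc by blast
  then obtain q where q: "y + i = Suc q" "x + i \<le> q" using \<open>x < y\<close>
    by (metis add_strict_right_mono less_imp_Suc_add le_add1 add_Suc_right less_Suc_eq_le)
  \<comment> \<open>The last of the \<open>j\<close> differences supplies strictness: it ends at
    index \<open>y + j\<close>, which is at least \<open>r\<close>, so the step from
    \<open>d q\<close> to \<open>d (Suc q)\<close> is strict.\<close>
  have "d (x + i) < d (y + i)"
    using step(2)[of q] mono[OF q(2)] \<open>r \<le> y + j\<close> j q by simp
  moreover have "(\<Sum>i<i. d (x + i)) \<le> (\<Sum>i<i. d (y + i))"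
    using assms by (intro sum_mono mono) auto
  ultimately show "\<gamma> k t r (x + j) - \<gamma> k t r x < \<gamma> k t r (y + j) - \<gamma> k t r y"
    unfolding tele by (simp add: j)
qed

definition extremal_value :: "nat \<Rightarrow> nat \<Rightarrow> nat \<Rightarrow> nat \<Rightarrow> real" where
  "extremal_value k t r n = real (n div t * t) + \<gamma> k t r (n mod t)"

text \<open>Let q = n mod t. If m + q < t, the claim compares the increments of \<gamma> of length m
  starting at 0 and at q. Otherwise one more full block appears, and by
  \<open>\<gamma> k t r t = real t\<close> the claim compares the increments of length t - q
  starting at m + q - t and at q. For \<open>r <= m\<close>, strict convexity makes either
  comparison strict unless the two starting points coincide, which means q = 0 or m = t.\<close>

lemma extremal_value_superadditive:
  assumes "2 \<le> r" "r \<le> t" "r < k" "m \<le> t"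
  shows "\<gamma> k t r m + extremal_value k t r n \<le> extremal_value k t r (m + n)"
    and "r \<le> m \<Longrightarrow> \<gamma> k t r m + extremal_value k t r n = extremal_value k t r (m + n)
      \<Longrightarrow> m = t \<or> n mod t = 0"
proof -
  define b q where "b = n div t" and "q = n mod t"
  have n: "n = b * t + q" "q < t" using assms by (auto simp: b_def q_def)
  have full: "\<gamma> k t r t = real t" using assms by (intro gamma_full) auto
  have L: "extremal_value k t r n = real (b * t) + \<gamma> k t r q"
    by (simp add: extremal_value_def b_def q_def)
  have less: "extremal_value k t r (m + n) = real (b * t) + \<gamma> k t r (m + q)" if "m + q < t"
  proof -
    have "(m + n) div t = b" "(m + n) mod t = m + q"
      using that n(1) by (auto simp: add.left_commute[of m] div_mult_self3)
    then show ?thesis by (simp add: extremal_value_def)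
  qed
  have ge: "extremal_value k t r (m + n) = real (b * t) + real t + \<gamma> k t r (m + q - t)" if "t \<le> m + q"
  proof -
    have "m + n = (m + q - t) + Suc b * t" "m + q - t < t"
      using that n assms by auto
    then have "(m + n) div t = Suc b" "(m + n) mod t = m + q - t"
      by (auto simp only: div_mult_self1 mod_mult_self1 div_less mod_less)
    then show ?thesis by (simp add: extremal_value_def)
  qed
  have "m + q - t \<le> q" using assms by simp
  note incr = gamma_increments[OF assms(1-3) this, of "t - q"]
  show "\<gamma> k t r m + extremal_value k t r n \<le> extremal_value k t r (m + n)"
    using gamma_increments(1)[OF assms(1-3), of 0 q m]
      incr(1) n assms L less ge full
    by (cases "m + q < t") (auto simp: add.commute)
  assume eq: "\<gamma> k t r m + extremal_value k t r n = extremal_value k t r (m + n)" and "r \<le> m"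
  show "m = t \<or> n mod t = 0"
  proof (rule ccontr)
    assume "\<not> ?thesis"
    then have "m < t" "0 < q" using assms by (auto simp: q_def)
    moreover from this have "m + q - t < q" by linarith
    ultimately show False
      using gamma_increments(2)[OF assms(1-3), of 0 q m] \<open>r \<le> m\<close>
        incr(2) n assms L less ge full eq
      by (cases "m + q < t") (auto simp: add.commute)
  qed
qed

section \<open>Cliques meeting a closed neighbourhood\<close>

text \<open>Vertex set and edge set are separate arguments because the inductions shrink
  \<open>V\<close> while \<open>E\<close> stays fixed; edges leaving \<open>V\<close> are then
  ignored.\<close>

definition closed_nbhd :: "'a set \<Rightarrow> 'a set set \<Rightarrow> 'a \<Rightarrow> 'a set" where
  "closed_nbhd V E v = insert v {w \<in> V. {v, w} \<in> E}"

lemma closed_nbhd_subset: "v \<in> V \<Longrightarrow> closed_nbhd V E v \<subseteq> V"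
  by (auto simp: closed_nbhd_def)

lemma cliques_Graph: "cliques r (Graph V E) = {Q \<in> [V]\<^bsup>r\<^esup>. clique Q E}"
  by (simp add: cliques_def)

text \<open>Double counting: a pair of \<open>v\<close> and a set \<open>Q\<close> avoiding it
  corresponds to the set \<open>W = insert v Q\<close> with the marked element \<open>v\<close>, and
  the product of \<open>z v\<close> with the monomial of \<open>Q\<close> is the monomial of
  \<open>W\<close>.\<close>

lemma sum_nsets_Suc:
  fixes z :: "'a \<Rightarrow> real"
  assumes V: "finite V"
  shows "(\<Sum>v\<in>V. z v * (\<Sum>Q\<in>{Q \<in> [V]\<^bsup>r\<^esup>. v \<notin> Q \<and> P v Q}. \<Prod>u\<in>Q. z u))
    = (\<Sum>W\<in>[V]\<^bsup>Suc r\<^esup>. real (card {v \<in> W. P v (W - {v})}) * (\<Prod>u\<in>W. z u))"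
proof -
  have fin: "finite ([V]\<^bsup>m\<^esup>)" for m using V by (rule finite_imp_finite_nsets)
  have finW: "finite W" if "W \<in> [V]\<^bsup>m\<^esup>" for W m using that by (simp add: nsets_def)
  have "(\<Sum>v\<in>V. z v * (\<Sum>Q\<in>{Q \<in> [V]\<^bsup>r\<^esup>. v \<notin> Q \<and> P v Q}. \<Prod>u\<in>Q. z u))
      = (\<Sum>(v, Q)\<in>(SIGMA v:V. {Q \<in> [V]\<^bsup>r\<^esup>. v \<notin> Q \<and> P v Q}). z v * (\<Prod>u\<in>Q. z u))"
    unfolding sum_distrib_left using V fin by (intro sum.Sigma) auto
  also have "\<dots> = (\<Sum>(W, v)\<in>(SIGMA W:[V]\<^bsup>Suc r\<^esup>. {v \<in> W. P v (W - {v})}). \<Prod>u\<in>W. z u)"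
    by (rule sum.reindex_bij_witness[where i = "\<lambda>(W, v). (v, W - {v})"
          and j = "\<lambda>(v, Q). (insert v Q, v)"])
      (auto simp: nsets_def insert_absorb card_insert_if)
  also have "\<dots> = (\<Sum>W\<in>[V]\<^bsup>Suc r\<^esup>. \<Sum>v\<in>{v \<in> W. P v (W - {v})}. \<Prod>u\<in>W. z u)"
    using fin finW by (intro sum.Sigma[symmetric]) auto
  finally show ?thesis by simp
qed

text \<open>A set \<open>W\<close> counted on the left is a clique minus part of the star at \<open>v\<close>. All the \<open>j \<ge> 1\<close>
  neighbours of \<open>v\<close> in \<open>W\<close> are counted on the right, whereas the left side counts only \<open>v\<close>, unless
  \<open>j = card W - 2\<close>, when it counts the two ends of the missing edge.\<close>

lemma card_partially_joined_le:
  assumes W: "finite W" "4 \<le> card W"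
  shows "card {v \<in> W. clique (W - {v}) E \<and> (\<exists>u\<in>W - {v}. {v, u} \<in> E) \<and> (\<exists>u\<in>W - {v}. {v, u} \<notin> E)}
    \<le> card {v \<in> W. (\<forall>u\<in>W - {v}. {v, u} \<in> E) \<and> \<not> clique (W - {v}) E}"
    (is "card ?X \<le> card ?Y")
proof (cases "?X = {}")
  case False
  then obtain v w where v: "v \<in> W" "clique (W - {v}) E" and w: "w \<in> W - {v}" "{v, w} \<notin> E"
    and nb: "\<exists>u\<in>W - {v}. {v, u} \<in> E"
    by auto
  let ?B = "{u \<in> W - {v}. {v, u} \<in> E}"
  have "?B \<subseteq> ?Y"
  proof
    fix u assume u: "u \<in> ?B"
    then have "{u, x} \<in> E" if "x \<in> W - {u}" for x
      using v that by (cases "x = v") (auto simp: clique_def insert_commute)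
    moreover have "\<not> clique (W - {u}) E"
    proof
      assume "clique (W - {u}) E"
      moreover have "v \<in> W - {u}" "w \<in> W - {u}" "v \<noteq> w" using u v w by auto
      ultimately show False using w unfolding clique_def by blast
    qed
    ultimately show "u \<in> ?Y" using u by auto
  qed
  then have le: "card ?B \<le> card ?Y" using W by (intro card_mono) auto
  show ?thesis
  proof (cases "?X \<subseteq> {v}")
    case True
    then have "card ?X \<le> 1" using card_mono[of "{v}" ?X] by simp
    moreover have "1 \<le> card ?B" using nb W by (simp add: Suc_le_eq card_gt_0_iff) blast
    ultimately show ?thesis using le by linarith
  next
    case False
    then obtain v' where v': "v' \<in> W" "v' \<noteq> v" "clique (W - {v'}) E" by auto
    \<comment> \<open>Since \<open>W - {v'}\<close> is a clique containing \<open>v\<close>, the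
      only non-neighbour of \<open>v\<close> in \<open>W\<close> is \<open>v'\<close>. Any further
      element of \<open>?X\<close> has a missing edge, which must end in \<open>v\<close> because
      \<open>W - {v}\<close> is a clique; so that element is \<open>v'\<close> as well.\<close>
    have eq: "x = v'" if "x \<in> W - {v}" "{v, x} \<notin> E" for x
    proof (rule ccontr)
      assume "x \<noteq> v'"
      then have "v \<in> W - {v'}" "x \<in> W - {v'}" "v \<noteq> x" using that v(1) v' by auto
      then show False using that(2) v'(3) unfolding clique_def by blast
    qed
    have "?X \<subseteq> {v, v'}"
    proof
      fix x assume x: "x \<in> ?X"
      then obtain y where y: "y \<in> W - {x}" "{x, y} \<notin> E" by auto
      show "x \<in> {v, v'}"
      proof (rule ccontr)
        assume "x \<notin> {v, v'}"
        then have x': "x \<in> W - {v}" "x \<noteq> v'" using x by auto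
        have "y = v"
        proof (rule ccontr)
          assume "y \<noteq> v"
          then have "y \<in> W - {v}" "x \<noteq> y" using y by auto
          then show False using x' y(2) v(2) unfolding clique_def by blast
        qed
        then show False using eq[OF x'(1)] x'(2) y(2) by (simp add: insert_commute)
      qed
    qed
    then have "card ?X \<le> card {v, v'}" by (intro card_mono) auto
    \<comment> \<open>At least four elements in \<open>W\<close> leave at least two after removing
      \<open>v\<close> and \<open>v'\<close>; for three elements this comparison can fail.\<close>
    also have "\<dots> \<le> card (W - {v, v'})" using v v' W by (simp add: card_Diff_subset)
    also have "\<dots> \<le> card ?B" using W eq by (intro card_mono) auto
    finally show ?thesis using le by linarith
  qed
next
  case True
  then show ?thesis by (simp only: card.empty le0)
qed

text \<open>The factor \<open>z v\<close> makes all contributions of a set \<open>W = insert v Q\<close> equal to the monomial of \<open>W\<close>,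
  whatever \<open>v\<close> is. The second sum on the left is slack that only matters in the case of equality.\<close>

lemma closed_nbhd_clique_inequality:
  fixes z :: "'a \<Rightarrow> real"
  assumes V: "finite V" and r: "3 \<le> r" and z: "\<And>v. v \<in> V \<Longrightarrow> 0 \<le> z v"
  shows "(\<Sum>v\<in>V. z v *
      ((\<Sum>Q\<in>{Q \<in> cliques r (Graph V E). Q \<inter> closed_nbhd V E v \<noteq> {}}. \<Prod>u\<in>Q. z u)
       + (\<Sum>A\<in>{A \<in> [closed_nbhd V E v]\<^bsup>r\<^esup>. v \<in> A \<and> \<not> clique A E}. \<Prod>u\<in>A. z u)))
    \<le> (\<Sum>v\<in>V. z v * (\<Sum>A\<in>[closed_nbhd V E v]\<^bsup>r\<^esup>. \<Prod>u\<in>A. z u))"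
proof -
  let ?N = "closed_nbhd V E"
  let ?P = "\<lambda>v Q. clique Q E \<and> Q \<inter> ?N v \<noteq> {} \<and> \<not> Q \<subseteq> ?N v"
  let ?R = "\<lambda>v A. A \<subseteq> ?N v \<and> \<not> clique A E"
  let ?\<pi> = "\<lambda>Q. \<Prod>u\<in>Q. z u"
  let ?S = "\<lambda>v. \<Sum>A\<in>{A \<in> [?N v]\<^bsup>r\<^esup>. v \<in> A \<and> \<not> clique A E}. ?\<pi> A"
  let ?C = "\<lambda>v. \<Sum>A\<in>{A \<in> [?N v]\<^bsup>r\<^esup>. clique A E}. ?\<pi> A"
  have fin: "finite ([V]\<^bsup>m\<^esup>)" for m using V by (rule finite_imp_finite_nsets)
  have finN: "finite ([?N v]\<^bsup>m\<^esup>)" if "v \<in> V" for v m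
    using V closed_nbhd_subset[OF that] finite_subset by (intro finite_imp_finite_nsets) blast
  \<comment> \<open>A clique through \<open>v\<close> lies inside \<open>?N v\<close>. So the
    cliques meeting \<open>?N v\<close> are those inside it, with sum \<open>?C v\<close>, and those
    that avoid \<open>v\<close> and lie only partly inside. The next fact splits all
    \<open>r\<close>-subsets of \<open>?N v\<close> so that \<open>?C v\<close> appears again and
    cancels, leaving the slack \<open>?S v\<close> and the non-cliques avoiding
    \<open>v\<close>.\<close>
  have meet: "(\<Sum>Q\<in>{Q \<in> cliques r (Graph V E). Q \<inter> ?N v \<noteq> {}}. ?\<pi> Q)
      = ?C v + (\<Sum>Q\<in>{Q \<in> [V]\<^bsup>r\<^esup>. v \<notin> Q \<and> ?P v Q}. ?\<pi> Q)" if v: "v \<in> V" for v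
  proof -
    have "Q \<subseteq> ?N v" if "clique Q E" "v \<in> Q" "Q \<subseteq> V" for Q
      using that by (auto simp: clique_def closed_nbhd_def)
    moreover have "A \<inter> ?N v \<noteq> {}" if "A \<in> [?N v]\<^bsup>r\<^esup>" for A
      using that r by (auto simp: nsets_def Int_absorb2)
    ultimately have eq: "{Q \<in> cliques r (Graph V E). Q \<inter> ?N v \<noteq> {}}
        = {A \<in> [?N v]\<^bsup>r\<^esup>. clique A E} \<union> {Q \<in> [V]\<^bsup>r\<^esup>. v \<notin> Q \<and> ?P v Q}"
      using closed_nbhd_subset[OF v, of E] unfolding cliques_Graph by (auto simp: nsets_def)
    show ?thesis
      unfolding eq
    proof (rule sum.union_disjoint)
      show "{A \<in> [?N v]\<^bsup>r\<^esup>. clique A E} \<inter> {Q \<in> [V]\<^bsup>r\<^esup>. v \<notin> Q \<and> ?P v Q} = {}"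
        by (auto simp: nsets_def)
    qed (use fin finN[OF v] in simp_all)
  qed
  have inside: "(\<Sum>A\<in>[?N v]\<^bsup>r\<^esup>. ?\<pi> A)
      = ?C v + ?S v + (\<Sum>A\<in>{A \<in> [V]\<^bsup>r\<^esup>. v \<notin> A \<and> ?R v A}. ?\<pi> A)" if v: "v \<in> V" for v
  proof -
    have eq: "[?N v]\<^bsup>r\<^esup> = {A \<in> [?N v]\<^bsup>r\<^esup>. clique A E}
        \<union> ({A \<in> [?N v]\<^bsup>r\<^esup>. v \<in> A \<and> \<not> clique A E} \<union> {A \<in> [V]\<^bsup>r\<^esup>. v \<notin> A \<and> ?R v A})"
      (is "_ = ?A \<union> (?B \<union> ?D)")
      using closed_nbhd_subset[OF v, of E] by (auto simp: nsets_def)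
    have finABD: "finite ?A" "finite ?B" "finite ?D"
      using fin finN[OF v] by simp_all
    have "sum ?\<pi> (?A \<union> (?B \<union> ?D)) = sum ?\<pi> ?A + sum ?\<pi> (?B \<union> ?D)"
      using finABD by (intro sum.union_disjoint) auto
    also have "sum ?\<pi> (?B \<union> ?D) = sum ?\<pi> ?B + sum ?\<pi> ?D"
      using finABD by (intro sum.union_disjoint) auto
    finally show ?thesis
      by (subst eq) (simp only: add.assoc)
  qed
  have "card {v \<in> W. ?P v (W - {v})} \<le> card {v \<in> W. ?R v (W - {v})}" if W: "W \<in> [V]\<^bsup>Suc r\<^esup>" for W
  proof -
    have N: "u \<in> ?N v \<longleftrightarrow> {v, u} \<in> E" if "u \<in> W - {v}" for u v
      using that W by (auto simp: nsets_def closed_nbhd_def)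
    have "{v \<in> W. ?P v (W - {v})} = {v \<in> W. clique (W - {v}) E \<and>
        (\<exists>u\<in>W - {v}. {v, u} \<in> E) \<and> (\<exists>u\<in>W - {v}. {v, u} \<notin> E)}"
      using N by (auto simp: subset_iff disjoint_iff)
    moreover have "{v \<in> W. ?R v (W - {v})}
        = {v \<in> W. (\<forall>u\<in>W - {v}. {v, u} \<in> E) \<and> \<not> clique (W - {v}) E}"
      using N by (auto simp: subset_iff)
    ultimately show ?thesis
      using card_partially_joined_le[of W E] W r by (auto simp: nsets_def)
  qed
  then have "(\<Sum>W\<in>[V]\<^bsup>Suc r\<^esup>. real (card {v \<in> W. ?P v (W - {v})}) * ?\<pi> W)
      \<le> (\<Sum>W\<in>[V]\<^bsup>Suc r\<^esup>. real (card {v \<in> W. ?R v (W - {v})}) * ?\<pi> W)"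
    using z by (intro sum_mono mult_right_mono prod_nonneg) (auto simp: nsets_def)
  then have "(\<Sum>v\<in>V. z v * (\<Sum>Q\<in>{Q \<in> [V]\<^bsup>r\<^esup>. v \<notin> Q \<and> ?P v Q}. ?\<pi> Q))
      \<le> (\<Sum>v\<in>V. z v * (\<Sum>A\<in>{A \<in> [V]\<^bsup>r\<^esup>. v \<notin> A \<and> ?R v A}. ?\<pi> A))"
    using sum_nsets_Suc[OF V, where P = ?P and r = r and z = z]
      sum_nsets_Suc[OF V, where P = ?R and r = r and z = z] by simp
  then show ?thesis
    by (simp add: meet inside ring_distribs sum.distrib)
qed

section \<open>The unconstrained problem\<close>

text \<open>The factor of \<open>clique_sum\<close> is 1/C_r, by the absorption identity for
  binomials used in \<open>capacity_eq\<close>. The factor \<open>r / k\<close> of the penalty is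
  chosen so that on rays this becomes the function of \<open>scalar_bound\<close>, whose maximiser
  has a simple closed form.\<close>

definition objective :: "nat \<Rightarrow> nat \<Rightarrow> nat \<Rightarrow> 'a ugraph \<Rightarrow> ('a \<Rightarrow> real) \<Rightarrow> real" where
  "objective k t r G z = real r / real ((t - 1) choose (r - 1)) * clique_sum r G z
     - real r / real k * (\<Sum>v\<in>verts G. z v ^ k)"

lemma clique_sum_scale: "clique_sum r G (\<lambda>v. s * z v) = s ^ r * clique_sum r G z"
  unfolding clique_sum_def sum_distrib_left
  by (intro sum.cong refl) (auto simp: cliques_def nsets_def prod.distrib)

lemma clique_sum_nonneg: "(\<And>v. v \<in> verts G \<Longrightarrow> 0 \<le> z v) \<Longrightarrow> 0 \<le> clique_sum r G z"
  unfolding clique_sum_def by (intro sum_nonneg prod_nonneg) (auto simp: cliques_def nsets_def)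

lemma clique_sum_zero:
  assumes "0 < r" "\<And>v. v \<in> verts G \<Longrightarrow> z v = 0"
  shows "clique_sum r G z = 0"
  unfolding clique_sum_def
proof (rule sum.neutral, rule ballI)
  fix Q assume "Q \<in> cliques r G"
  then have "finite Q" "Q \<noteq> {}" "Q \<subseteq> verts G" using assms(1) by (auto simp: cliques_def nsets_def)
  then show "(\<Prod>v\<in>Q. z v) = 0" using assms(2) by (auto intro!: prod_zero)
qed

lemma objective_zero:
  assumes "0 < r" "0 < k" "\<And>v. v \<in> verts G \<Longrightarrow> z v = 0"
  shows "objective k t r G z = 0"
  using assms by (simp add: objective_def clique_sum_zero)

lemma capacity_eq:
  assumes "0 < r" "r \<le> t"
  shows "capacity k t r G
    = (real r / real ((t - 1) choose (r - 1)) * clique_lagrangian k r G) powr \<sigma> k r"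
proof -
  have "real r * real (t choose r) = real t * real ((t - 1) choose (r - 1))"
    using times_binomial_minus1_eq[OF assms(1), of t] by (metis of_nat_mult)
  moreover have "real ((t - 1) choose (r - 1)) \<noteq> 0" "real (t choose r) \<noteq> 0"
    using assms by auto
  ultimately have "clique_lagrangian k r G / (1 / real t * real (t choose r))
      = real r / real ((t - 1) choose (r - 1)) * clique_lagrangian k r G"
    using assms by (simp add: field_simps)
  then show ?thesis by (simp add: capacity_def)
qed

text \<open>On the ray through a unit vector the normalised problem is the scalar one of
  \<open>scalar_bound\<close>; its maximum over the scale turns \<open>L\<^sub>r\<close> into the capacity.\<close>

lemma capacity_attained:
  assumes "0 < r" "r \<le> t" "r < k" "finite (verts G)"
  shows "\<exists>z. (\<forall>v\<in>verts G. 0 \<le> z v) \<and>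
    objective k t r G z = (1 - real r / real k) * capacity k t r G"
proof (cases "verts G = {}")
  case True
  then have "capacity k t r G = 0"
    using assms by (simp add: capacity_eq clique_lagrangian_def)
  then show ?thesis
    using objective_zero[of r k G "\<lambda>_. 0" t] assms by (auto intro!: exI[of _ "\<lambda>_. 0"])
next
  case False
  obtain y where y: "y \<in> unit_vectors k G" "clique_sum r G y = clique_lagrangian k r G"
    using clique_lagrangian_attained[OF assms(4) False, of k r] assms by auto
  define a where "a = real r / real ((t - 1) choose (r - 1)) * clique_lagrangian k r G"
  define s where "s = a powr (1 / real (k - r))"
  have y0: "0 \<le> y v" if "v \<in> verts G" for v using y(1) that by (simp add: unit_vectors_def)
  have "0 \<le> a"
    unfolding a_def y(2)[symmetric] using y0 by (intro mult_nonneg_nonneg clique_sum_nonneg) auto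
  have "(\<Sum>v\<in>verts G. (s * y v) ^ k) = s ^ k * (\<Sum>v\<in>verts G. y v ^ k)"
    by (simp add: power_mult_distrib sum_distrib_left)
  then have "objective k t r G (\<lambda>v. s * y v) = a * s ^ r - real r / real k * s ^ k"
    using y(1) by (simp add: objective_def clique_sum_scale y(2) a_def unit_vectors_def)
  also have "\<dots> = (1 - real r / real k) * a powr \<sigma> k r"
    using scalar_bound(2)[OF \<open>0 \<le> a\<close> _ assms(3,1), of s] by (simp add: s_def)
  finally show ?thesis
    using y0 assms by (auto simp: capacity_eq a_def s_def intro!: exI[of _ "\<lambda>v. s * y v"])
qed

text \<open>Every vector that is nonzero on the vertex set is a unit vector scaled by the
  \<open>k\<close>-th root \<open>s\<close> of its power sum, so \<open>scalar_bound\<close> applies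
  at \<open>s\<close>. The zero vector lies on no such ray and has objective 0.\<close>

lemma objective_le_capacity:
  assumes "0 < r" "r \<le> t" "r < k" "finite (verts G)" and z: "\<And>v. v \<in> verts G \<Longrightarrow> 0 \<le> z v"
  shows "objective k t r G z \<le> (1 - real r / real k) * capacity k t r G"
proof (cases "\<forall>v\<in>verts G. z v = 0")
  case True
  then show ?thesis
    using objective_zero[of r k G z t] assms by (simp add: capacity_def)
next
  case False
  then obtain w where w: "w \<in> verts G" "z w \<noteq> 0" by auto
  define M where "M = (\<Sum>v\<in>verts G. z v ^ k)"
  have "0 < z w ^ k" using w z[OF w(1)] by (simp add: zero_less_power)
  then have M: "0 < M"
    unfolding M_def using w z assms(4) by (intro sum_pos2[of _ w]) auto
  define s where "s = root k M"
  have s: "0 < s" "s ^ k = M" using M assms by (auto simp: s_def real_root_pow_pos2)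
  define y where "y v = z v / s" for v
  have zy: "z = (\<lambda>v. s * y v)" using s by (auto simp: y_def)
  have y: "y \<in> unit_vectors k G"
    using z s M by (auto simp: unit_vectors_def y_def power_divide M_def simp flip: sum_divide_distrib)
  have "clique_sum r G y \<le> clique_lagrangian k r G"
    using clique_lagrangian_attained[OF assms(4), of k r] w y assms by fastforce
  then have "clique_sum r G z \<le> s ^ r * clique_lagrangian k r G"
    using s unfolding zy clique_sum_scale by (intro mult_left_mono) auto
  define a where "a = real r / real ((t - 1) choose (r - 1)) * clique_lagrangian k r G"
  have "0 \<le> clique_lagrangian k r G"
    using \<open>clique_sum r G y \<le> _\<close> clique_sum_nonneg[of G y r] y by (force simp: unit_vectors_def)
  then have "0 \<le> a" by (simp add: a_def)
  have "objective k t r G z \<le> a * s ^ r - real r / real k * s ^ k"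
    using mult_left_mono[OF \<open>clique_sum r G z \<le> _\<close>, of "real r / real ((t - 1) choose (r - 1))"]
    by (simp add: objective_def a_def s(2) M_def mult_ac)
  also have "\<dots> \<le> (1 - real r / real k) * a powr \<sigma> k r"
    using \<open>0 \<le> a\<close> s assms by (intro scalar_bound(1)) auto
  finally show ?thesis using assms by (simp add: capacity_eq a_def)
qed

section \<open>Complete graphs, and the removal of a set of vertices\<close>

definition full_objective :: "nat \<Rightarrow> nat \<Rightarrow> nat \<Rightarrow> 'a set \<Rightarrow> ('a \<Rightarrow> real) \<Rightarrow> real" where
  "full_objective k t r N z = real r / real ((t - 1) choose (r - 1)) * (\<Sum>A\<in>[N]\<^bsup>r\<^esup>. \<Prod>v\<in>A. z v)
     - real r / real k * (\<Sum>v\<in>N. z v ^ k)"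

text \<open>The maximiser given by \<open>scalar_bound\<close> for the coefficient that arises on a
  complete graph of order \<open>m\<close>.\<close>

definition full_weight :: "nat \<Rightarrow> nat \<Rightarrow> nat \<Rightarrow> nat \<Rightarrow> real" where
  "full_weight k t r m =
     (real ((m - 1) choose (r - 1)) / real ((t - 1) choose (r - 1))) powr (1 / real (k - r))"

text \<open>After \<open>nsets_prod_sum_le\<close> the variables separate, and
  \<open>scalar_bound\<close> with the same coefficient \<open>c\<close> bounds each summand; by
  \<open>gamma_eq\<close> the maxima add up to the right side. In the case of equality every summand
  is maximal, and uniqueness of the scalar maximiser fixes every coordinate.\<close>

lemma full_objective_le:
  fixes z :: "'a \<Rightarrow> real"
  assumes "2 \<le> r" "r \<le> t" "r < k" "finite N" and z: "\<And>v. v \<in> N \<Longrightarrow> 0 \<le> z v"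
  shows "full_objective k t r N z \<le> (1 - real r / real k) * \<gamma> k t r (card N)"
    and "full_objective k t r N z = (1 - real r / real k) * \<gamma> k t r (card N)
      \<Longrightarrow> v \<in> N \<Longrightarrow> z v = full_weight k t r (card N)"
proof -
  define c where "c = real ((card N - 1) choose (r - 1)) / real ((t - 1) choose (r - 1))"
  have c: "0 \<le> c" by (simp add: c_def)
  let ?f = "\<lambda>v. c * z v ^ r - real r / real k * z v ^ k"
  let ?g = "\<lambda>v. (1 - real r / real k) * c powr \<sigma> k r"
  have fg: "?f v \<le> ?g v" if "v \<in> N" for v
    using scalar_bound(1)[OF c z[OF that] assms(3)] .
  have le_f: "full_objective k t r N z \<le> (\<Sum>v\<in>N. ?f v)"
  proof -
    have "real r * (\<Sum>A\<in>[N]\<^bsup>r\<^esup>. \<Prod>v\<in>A. z v) / real ((t - 1) choose (r - 1))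
        \<le> real ((card N - 1) choose (r - 1)) * (\<Sum>v\<in>N. z v ^ r) / real ((t - 1) choose (r - 1))"
      using assms by (intro divide_right_mono nsets_prod_sum_le) auto
    moreover have "(\<Sum>v\<in>N. ?f v) = c * (\<Sum>v\<in>N. z v ^ r) - real r / real k * (\<Sum>v\<in>N. z v ^ k)"
      by (simp only: sum_subtractf sum_distrib_left)
    ultimately show ?thesis
      by (simp add: full_objective_def c_def)
  qed
  have sum_g: "(\<Sum>v\<in>N. ?g v) = (1 - real r / real k) * \<gamma> k t r (card N)"
    using assms by (simp add: gamma_eq c_def)
  have f_le_g: "(\<Sum>v\<in>N. ?f v) \<le> (\<Sum>v\<in>N. ?g v)"
    using fg by (rule sum_mono)
  show "full_objective k t r N z \<le> (1 - real r / real k) * \<gamma> k t r (card N)"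
    using le_f sum_g f_le_g by linarith
  assume "full_objective k t r N z = (1 - real r / real k) * \<gamma> k t r (card N)" and v: "v \<in> N"
  with le_f sum_g f_le_g have "sum ?f N = sum ?g N" by linarith
  then have "?f v = ?g v"
    using sum_mono_inv[of ?f N ?g v] fg v assms(4) by blast
  then show "z v = full_weight k t r (card N)"
    using scalar_bound(2)[OF c z[OF v] assms(3)] assms(1) by (simp add: c_def full_weight_def)
qed

lemma full_objective_const:
  assumes "2 \<le> r" "r \<le> t" "r < k" "finite N" and z: "\<And>v. v \<in> N \<Longrightarrow> z v = full_weight k t r (card N)"
  shows "full_objective k t r N z = (1 - real r / real k) * \<gamma> k t r (card N)"
proof -
  define c where "c = real ((card N - 1) choose (r - 1)) / real ((t - 1) choose (r - 1))"
  define s where "s = full_weight k t r (card N)"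
  have c: "0 \<le> c" by (simp add: c_def)
  have "(\<Sum>A\<in>[N]\<^bsup>r\<^esup>. \<Prod>v\<in>A. z v) = (\<Sum>A\<in>[N]\<^bsup>r\<^esup>. s ^ r)"
    using z by (intro sum.cong) (auto simp: nsets_def s_def subset_iff)
  also have "real r * \<dots> = real (card N) * real ((card N - 1) choose (r - 1)) * s ^ r"
    using times_binomial_minus1_eq[of r "card N"] assms
    by (simp add: card_nsets mult.assoc[symmetric] flip: of_nat_mult)
  finally have "full_objective k t r N z = real (card N) * (c * s ^ r - real r / real k * s ^ k)"
    using z by (simp add: full_objective_def c_def s_def field_simps)
  also have "c * s ^ r - real r / real k * s ^ k = (1 - real r / real k) * c powr \<sigma> k r"
    using scalar_bound(2)[OF c _ assms(3), of s] assms by (simp add: s_def c_def full_weight_def)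
  finally show ?thesis using assms by (simp add: gamma_eq c_def)
qed

text \<open>Each clique avoids \<open>N\<close> or meets it; the sum over all
  \<open>r\<close>-subsets of \<open>N\<close> is added and subtracted. The last bracket compares
  the cliques meeting \<open>N\<close> with a complete graph on \<open>N\<close>, which is the
  comparison made in \<open>closed_nbhd_clique_inequality\<close>.\<close>

lemma objective_split:
  assumes V: "finite V" and N: "N \<subseteq> V"
  shows "objective k t r (Graph V E) z = objective k t r (Graph (V - N) E) z + full_objective k t r N z
    + real r / real ((t - 1) choose (r - 1)) *
      ((\<Sum>Q\<in>{Q \<in> cliques r (Graph V E). Q \<inter> N \<noteq> {}}. \<Prod>u\<in>Q. z u) - (\<Sum>A\<in>[N]\<^bsup>r\<^esup>. \<Prod>u\<in>A. z u))"
proof -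
  have eq: "cliques r (Graph V E) = cliques r (Graph (V - N) E) \<union> {Q \<in> cliques r (Graph V E). Q \<inter> N \<noteq> {}}"
    by (auto simp: cliques_Graph nsets_def)
  have "finite (cliques r (Graph V E))"
    using V by (simp add: cliques_Graph finite_imp_finite_nsets)
  moreover have "finite (cliques r (Graph (V - N) E))"
    using V by (simp add: cliques_Graph finite_imp_finite_nsets)
  moreover have "cliques r (Graph (V - N) E) \<inter> {Q \<in> cliques r (Graph V E). Q \<inter> N \<noteq> {}} = {}"
    by (auto simp: cliques_Graph nsets_def)
  ultimately have "clique_sum r (Graph V E) z = clique_sum r (Graph (V - N) E) z
      + (\<Sum>Q\<in>{Q \<in> cliques r (Graph V E). Q \<inter> N \<noteq> {}}. \<Prod>u\<in>Q. z u)"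
    unfolding clique_sum_def by (subst eq, subst sum.union_disjoint) auto
  moreover have "(\<Sum>v\<in>V. z v ^ k) = (\<Sum>v\<in>V - N. z v ^ k) + (\<Sum>v\<in>N. z v ^ k)"
    using V N by (rule sum.subset_diff[rotated])
  ultimately show ?thesis
    by (simp add: objective_def full_objective_def algebra_simps)
qed

section \<open>The upper bound by induction on the order\<close>

lemma extremal_value_nonneg: "0 \<le> extremal_value k t r n"
  by (simp add: extremal_value_def gamma_nonneg)

lemma card_closed_nbhd_Diff:
  assumes "finite V" "\<And>v. v \<in> V \<Longrightarrow> card (closed_nbhd V E v) \<le> t" "v \<in> V - N"
  shows "card (closed_nbhd (V - N) E v) \<le> t"
proof -
  have "card (closed_nbhd (V - N) E v) \<le> card (closed_nbhd V E v)"
    using assms by (intro card_mono) (auto simp: closed_nbhd_def)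
  then show ?thesis using assms(2)[of v] assms(3) by simp
qed

lemma objective_le_extremal_value:
  fixes z :: "'a \<Rightarrow> real"
  assumes "3 \<le> r" "r \<le> t" "r < k"
    and "finite V" "\<And>v. v \<in> V \<Longrightarrow> card (closed_nbhd V E v) \<le> t" "\<And>v. v \<in> V \<Longrightarrow> 0 \<le> z v"
  shows "objective k t r (Graph V E) z \<le> (1 - real r / real k) * extremal_value k t r (card V)"
  using assms(4-6)
proof (induction "card V" arbitrary: V rule: less_induct)
  case less
  let ?N = "closed_nbhd V E"
  define T where "T v = (\<Sum>Q\<in>{Q \<in> cliques r (Graph V E). Q \<inter> ?N v \<noteq> {}}. \<Prod>u\<in>Q. z u)" for v
  define S where "S v = (\<Sum>A\<in>{A \<in> [?N v]\<^bsup>r\<^esup>. v \<in> A \<and> \<not> clique A E}. \<Prod>u\<in>A. z u)" for v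
  define B where "B v = (\<Sum>A\<in>[?N v]\<^bsup>r\<^esup>. \<Prod>u\<in>A. z u)" for v
  have rk: "0 \<le> 1 - real r / real k" using assms by simp
  show ?case
  proof (cases "\<forall>v\<in>V. z v = 0")
    case True
    then show ?thesis
      using objective_zero[of r k "Graph V E" z t] assms rk extremal_value_nonneg by simp
  next
    case False
    then obtain w where w: "w \<in> V" "0 < z w" using less.prems(3) by force
    have key: "(\<Sum>v\<in>V. z v * (T v + S v)) \<le> (\<Sum>v\<in>V. z v * B v)"
      unfolding T_def S_def B_def using less.prems assms by (intro closed_nbhd_clique_inequality)
    \<comment> \<open>Averaging: if the inequality failed at every vertex of positive weight,
      summing would contradict \<open>key\<close>, with strictness supplied by
      \<open>w\<close>.\<close>
    obtain v where v: "v \<in> V" "0 < z v" "T v + S v \<le> B v"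
    proof (rule ccontr)
      assume "\<not> thesis"
      with that have less: "B v < T v + S v" if "v \<in> V" "0 < z v" for v
        using that by (metis not_le)
      have "(\<Sum>v\<in>V. z v * B v) < (\<Sum>v\<in>V. z v * (T v + S v))"
      proof (rule sum_strict_mono_ex1)
        show "\<forall>v\<in>V. z v * B v \<le> z v * (T v + S v)"
          using less less.prems(3) by (metis less_eq_real_def mult_left_mono mult_zero_left)
        show "\<exists>v\<in>V. z v * B v < z v * (T v + S v)"
          using less[OF w] w by (auto intro!: bexI[of _ w])
      qed (use less.prems in auto)
      then show False using key by simp
    qed
    have N: "?N v \<subseteq> V" "v \<in> ?N v" using closed_nbhd_subset[OF v(1)] by (auto simp: closed_nbhd_def)
    have "0 \<le> S v"
      unfolding S_def using less.prems(3) N by (intro sum_nonneg prod_nonneg) (auto simp: nsets_def)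
    then have "real r / real ((t - 1) choose (r - 1)) * (T v - B v) \<le> 0"
      using v(3) by (intro mult_nonneg_nonpos) auto
    then have "objective k t r (Graph V E) z
        \<le> objective k t r (Graph (V - ?N v) E) z + full_objective k t r (?N v) z"
      using objective_split[OF less.prems(1) N(1), of k t r E z] by (simp add: T_def B_def)
    also have "objective k t r (Graph (V - ?N v) E) z
        \<le> (1 - real r / real k) * extremal_value k t r (card (V - ?N v))"
    proof (rule less.hyps)
      show "card (V - ?N v) < card V"
        using less.prems(1) N v(1) by (intro psubset_card_mono) auto
    qed (use less.prems card_closed_nbhd_Diff[OF less.prems(1,2)] in auto)
    also have "full_objective k t r (?N v) z \<le> (1 - real r / real k) * \<gamma> k t r (card (?N v))"
      using assms less.prems N finite_subset by (intro full_objective_le(1)) auto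
    also have "(1 - real r / real k) * extremal_value k t r (card (V - ?N v))
        + (1 - real r / real k) * \<gamma> k t r (card (?N v))
        = (1 - real r / real k) * (\<gamma> k t r (card (?N v)) + extremal_value k t r (card (V - ?N v)))"
      by (simp add: algebra_simps)
    also have "\<dots> \<le> (1 - real r / real k) * extremal_value k t r (card (?N v) + card (V - ?N v))"
      using assms less.prems(2)[OF v(1)] rk
      by (intro mult_left_mono extremal_value_superadditive) auto
    also have "card (?N v) + card (V - ?N v) = card V"
      using less.prems(1) N(1) by (simp add: card_Diff_subset finite_subset card_mono)
    finally show ?thesis by simp
  qed
qed

section \<open>The case of equality\<close>

lemma full_weight_pos_iff:
  assumes "2 \<le> r" "r \<le> t"
  shows "0 < full_weight k t r m \<longleftrightarrow> r \<le> m"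
  using assms by (cases "m = 0") (auto simp: full_weight_def)

text \<open>Equality makes every estimate of the inductive step tight at each vertex of the support.
  Tightness on the closed neighbourhood gives constant positive weights there, so the neighbourhood
  stays in the support. The vanishing slack \<open>S\<close> makes it a clique, and equality in
  \<open>extremal_value_superadditive\<close> yields the alternative about orders.\<close>

lemma objective_eq_extremal_value:
  fixes z :: "'a \<Rightarrow> real"
  assumes "3 \<le> r" "r \<le> t" "r < k"
    and V: "finite V" and deg_le: "\<forall>v\<in>V. card (closed_nbhd V E v) \<le> t"
    and nonneg: "\<forall>v\<in>V. 0 \<le> z v"
    and eq: "objective k t r (Graph V E) z = (1 - real r / real k) * extremal_value k t r (card V)"
    and v: "v \<in> V" "0 < z v"
  defines "N \<equiv> closed_nbhd V E v"
  shows "clique N E" and "\<And>u w. u \<in> N \<Longrightarrow> w \<in> V - N \<Longrightarrow> {u, w} \<notin> E"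
    and "r \<le> card N" and "card N = t \<or> card (V - N) mod t = 0"
    and "objective k t r (Graph (V - N) E) z = (1 - real r / real k) * extremal_value k t r (card (V - N))"
proof -
  let ?N = "closed_nbhd V E"
  let ?\<kappa> = "1 - real r / real k"
  let ?ext = "extremal_value k t r"
  define T where "T v = (\<Sum>Q\<in>{Q \<in> cliques r (Graph V E). Q \<inter> ?N v \<noteq> {}}. \<Prod>u\<in>Q. z u)" for v
  define S where "S v = (\<Sum>A\<in>{A \<in> [?N v]\<^bsup>r\<^esup>. v \<in> A \<and> \<not> clique A E}. \<Prod>u\<in>A. z u)" for v
  define B where "B v = (\<Sum>A\<in>[?N v]\<^bsup>r\<^esup>. \<Prod>u\<in>A. z u)" for v
  define \<rho> where "\<rho> = real r / real ((t - 1) choose (r - 1))"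
  note deg = deg_le[rule_format] and z = nonneg[rule_format]
  have \<rho>: "0 < \<rho>" using assms(1,2) by (simp add: \<rho>_def)
  have \<kappa>: "0 < ?\<kappa>" using assms(3) by simp
  have sub: "?N w \<subseteq> V" if "w \<in> V" for w using closed_nbhd_subset[OF that] .
  have finN: "finite (?N w)" if "w \<in> V" for w using sub[OF that] V by (rule finite_subset)
  have split: "objective k t r (Graph V E) z = objective k t r (Graph (V - ?N w) E) z
      + full_objective k t r (?N w) z + \<rho> * (T w - B w)" if "w \<in> V" for w
    using objective_split[OF V sub[OF that]] by (simp add: T_def B_def \<rho>_def)
  have rest: "objective k t r (Graph (V - ?N w) E) z \<le> ?\<kappa> * ?ext (card (V - ?N w))" for w
    using assms(1-3) V z card_closed_nbhd_Diff[OF V deg]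
    by (intro objective_le_extremal_value) auto
  have full: "full_objective k t r (?N w) z \<le> ?\<kappa> * \<gamma> k t r (card (?N w))" if "w \<in> V" for w
    using assms(1-3) finN[OF that] sub[OF that] z by (intro full_objective_le(1)) auto
  have cards: "card (?N w) + card (V - ?N w) = card V" if "w \<in> V" for w
    using V sub[OF that] finN[OF that] by (simp add: card_Diff_subset card_mono)
  have super: "\<gamma> k t r (card (?N w)) + ?ext (card (V - ?N w)) \<le> ?ext (card V)" if "w \<in> V" for w
    using extremal_value_superadditive(1)[of r t k "card (?N w)" "card (V - ?N w)"]
      assms(1-3) deg[OF that] cards[OF that] by simp
  then have \<kappa>super: "?\<kappa> * \<gamma> k t r (card (?N w)) + ?\<kappa> * ?ext (card (V - ?N w)) \<le> ?\<kappa> * ?ext (card V)"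
    if "w \<in> V" for w
    using mult_left_mono[OF super[OF that] less_imp_le[OF \<kappa>]] by (simp only: distrib_left)
  \<comment> \<open>If \<open>T w < B w\<close> held anywhere, \<open>split\<close> and the bounds
    on its parts would put the objective strictly below its assumed value. Thus
    \<open>B w <= T w\<close> at every vertex, while the neighbourhood inequality bounds the
    weighted sum of \<open>T w + S w - B w\<close> by 0; hence each of its terms vanishes.\<close>
  have "0 \<le> \<rho> * (T w - B w)" if "w \<in> V" for w
    using split[OF that] rest[of w] full[OF that] \<kappa>super[OF that] eq by linarith
  then have TB: "B w \<le> T w" if "w \<in> V" for w
    using that \<rho> by (simp add: zero_le_mult_iff)
  have S: "0 \<le> S w" if "w \<in> V" for w
    unfolding S_def using z sub[OF that] by (intro sum_nonneg prod_nonneg) (auto simp: nsets_def)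
  have "(\<Sum>w\<in>V. z w * (T w + S w)) \<le> (\<Sum>w\<in>V. z w * B w)"
    unfolding T_def S_def B_def using V z assms(1) by (intro closed_nbhd_clique_inequality)
  then have "(\<Sum>w\<in>V. z w * (T w + S w - B w)) \<le> 0"
    by (simp add: right_diff_distrib sum_subtractf)
  moreover have terms: "0 \<le> z w * (T w + S w - B w)" if "w \<in> V" for w
    using that TB[OF that] S[OF that] z by (intro mult_nonneg_nonneg) auto
  ultimately have "(\<Sum>w\<in>V. z w * (T w + S w - B w)) = 0"
    by (intro order_antisym sum_nonneg)
  then have zero: "\<forall>w\<in>V. z w * (T w + S w - B w) = 0"
    using terms by (subst (asm) sum_nonneg_eq_0_iff[OF V]) auto
  have TSB: "T w = B w" "S w = 0" if "w \<in> V" "0 < z w" for w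
  proof -
    have "T w + S w - B w = 0" using zero that by auto
    then show "T w = B w" "S w = 0" using TB[OF that(1)] S[OF that(1)] by linarith+
  qed
  have tight: "full_objective k t r (?N w) z = ?\<kappa> * \<gamma> k t r (card (?N w))"
    "objective k t r (Graph (V - ?N w) E) z = ?\<kappa> * ?ext (card (V - ?N w))"
    "\<gamma> k t r (card (?N w)) + ?ext (card (V - ?N w)) = ?ext (card V)" if w: "w \<in> V" "0 < z w" for w
  proof -
    have "objective k t r (Graph (V - ?N w) E) z + full_objective k t r (?N w) z = ?\<kappa> * ?ext (card V)"
      using split[OF w(1)] TSB(1)[OF w] eq by simp
    then have le: "full_objective k t r (?N w) z = ?\<kappa> * \<gamma> k t r (card (?N w))
      \<and> objective k t r (Graph (V - ?N w) E) z = ?\<kappa> * ?ext (card (V - ?N w))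
      \<and> ?\<kappa> * \<gamma> k t r (card (?N w)) + ?\<kappa> * ?ext (card (V - ?N w)) = ?\<kappa> * ?ext (card V)"
      using rest[of w] full[OF w(1)] \<kappa>super[OF w(1)] by linarith
    then have "?\<kappa> * (\<gamma> k t r (card (?N w)) + ?ext (card (V - ?N w))) = ?\<kappa> * ?ext (card V)"
      by (simp only: distrib_left)
    then show "\<gamma> k t r (card (?N w)) + ?ext (card (V - ?N w)) = ?ext (card V)"
      using \<kappa> by (metis less_irrefl mult_cancel_left)
    show "full_objective k t r (?N w) z = ?\<kappa> * \<gamma> k t r (card (?N w))"
      "objective k t r (Graph (V - ?N w) E) z = ?\<kappa> * ?ext (card (V - ?N w))"
      using le by blast+
  qed
  \<comment> \<open>All coordinates on \<open>?N w\<close> equal the unique maximiser. Since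
    \<open>z w\<close> is positive, this value is positive, which forces
    \<open>r <= card (?N w)\<close> and then positivity on all of \<open>?N w\<close>.\<close>
  have weight: "z u = full_weight k t r (card (?N w))" if "w \<in> V" "0 < z w" "u \<in> ?N w" for u w
    using assms(1-3) finN[OF that(1)] sub[OF that(1)] z tight(1)[OF that(1,2)] that(3)
    by (intro full_objective_le(2)) auto
  have size: "r \<le> card (?N w)" if "w \<in> V" "0 < z w" for w
    using weight[OF that, of w] that(2) full_weight_pos_iff[of r t k] assms(1,2)
    by (simp add: closed_nbhd_def)
  have pos: "0 < z u" if "w \<in> V" "0 < z w" "u \<in> ?N w" for u w
    using weight[OF that] size[OF that(1,2)] full_weight_pos_iff[of r t k] assms(1,2) by simp
  have clq: "clique (?N w) E" if w: "w \<in> V" "0 < z w" for w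
    unfolding clique_def
  proof (intro ballI impI)
    fix x y assume xy: "x \<in> ?N w" "y \<in> ?N w" "x \<noteq> y"
    have "w \<in> ?N w" by (simp add: closed_nbhd_def)
    \<comment> \<open>As \<open>r\<close> is at least 3, the pair together with \<open>w\<close>
      extends to an \<open>r\<close>-subset of \<open>?N w\<close>. If that subset were not a
      clique, its positive monomial would occur in \<open>S w\<close>.\<close>
    have "card {w, x, y} \<le> r" using assms(1) by (intro order_trans[OF card_insert_le_m1]) (auto simp: card_insert_if)
    then obtain A where A: "{w, x, y} \<subseteq> A" "A \<subseteq> ?N w" "card A = r"
      using exists_subset_between[of "{w, x, y}" r "?N w"] size[OF w] finN[OF w(1)] xy \<open>w \<in> ?N w\<close>
      by auto
    have "clique A E"
    proof (rule ccontr)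
      assume "\<not> clique A E"
      then have mem: "A \<in> {A \<in> [?N w]\<^bsup>r\<^esup>. w \<in> A \<and> \<not> clique A E}"
        using A finN[OF w(1)] by (auto simp: nsets_def finite_subset)
      have "0 < (\<Prod>u\<in>A. z u)" using pos[OF w] A(2) by (intro prod_pos) auto
      then have "0 < S w"
        unfolding S_def using mem finN[OF w(1)] z sub[OF w(1)]
        by (intro sum_pos2[OF _ mem]) (auto simp: finite_imp_finite_nsets nsets_def intro!: prod_nonneg)
      then show False using TSB(2)[OF w] by simp
    qed
    then show "{x, y} \<in> E" using A(1) xy(3) by (auto simp: clique_def)
  qed
  show "clique N E" unfolding N_def by (rule clq[OF v])
  show "r \<le> card N" unfolding N_def by (rule size[OF v])
  show "objective k t r (Graph (V - N) E) z = ?\<kappa> * ?ext (card (V - N))"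
    unfolding N_def by (rule tight(2)[OF v])
  show "card N = t \<or> card (V - N) mod t = 0"
    using extremal_value_superadditive(2)[of r t k "card N" "card (V - N)"] tight(3)[OF v]
      size[OF v] cards[OF v(1)] deg[OF v(1)] assms(1-3) by (simp add: N_def)
  \<comment> \<open>The vertex \<open>u\<close> is in the support too, so its closed neighbourhood
    is a clique. An edge from \<open>u\<close> to \<open>w\<close> would put both \<open>v\<close>
    and \<open>w\<close> into that clique and hence \<open>w\<close> into \<open>N\<close>.\<close>
  show "{u, w} \<notin> E" if u: "u \<in> N" and w: "w \<in> V - N" for u w
  proof
    assume "{u, w} \<in> E"
    have uV: "u \<in> V" using u sub[OF v(1)] by (auto simp: N_def)
    have "v \<in> ?N u"
      using u v(1) by (auto simp: N_def closed_nbhd_def insert_commute)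
    moreover have "w \<in> ?N u" using w \<open>{u, w} \<in> E\<close> by (auto simp: closed_nbhd_def)
    moreover have "v \<noteq> w" using w by (auto simp: N_def closed_nbhd_def)
    ultimately have "{v, w} \<in> E"
      using clq[OF uV pos[OF v]] u by (auto simp: N_def clique_def)
    then show False using w by (auto simp: N_def closed_nbhd_def)
  qed
qed

section \<open>Decompositions into isolated cliques and a remainder\<close>

text \<open>The parts with index below \<open>b\<close> are the copies of \<open>K\<^sub>t\<close>; the part with index \<open>b\<close> is the remainder.\<close>

definition clique_decomposition ::
  "nat \<Rightarrow> nat \<Rightarrow> 'a set \<Rightarrow> 'a set set \<Rightarrow> nat \<Rightarrow> nat \<Rightarrow> (nat \<Rightarrow> 'a set) \<Rightarrow> bool" where
  "clique_decomposition t r V E b p g \<longleftrightarrow>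
     (\<Union>i\<le>b. g i) = V \<and> disjoint_family_on g {..b}
     \<and> (\<forall>i<b. card (g i) = t \<and> clique (g i) E)
     \<and> card (g b) = p \<and> (r \<le> p \<longrightarrow> clique (g b) E)
     \<and> (\<forall>i\<le>b. \<forall>j\<le>b. i \<noteq> j \<longrightarrow> (\<forall>x\<in>g i. \<forall>y\<in>g j. {x, y} \<notin> E))"

text \<open>By \<open>objective_eq_extremal_value\<close>, the closed neighbourhood of a support
  vertex is an isolated clique whose removal preserves equality, so the components are split off one
  at a time.\<close>

lemma clique_decomposition_exists:
  fixes z :: "'a \<Rightarrow> real"
  assumes "3 \<le> r" "r \<le> t" "r < k"
    and "finite V" "\<And>v. v \<in> V \<Longrightarrow> card (closed_nbhd V E v) \<le> t" "\<And>v. v \<in> V \<Longrightarrow> 0 \<le> z v"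
    and "objective k t r (Graph V E) z = (1 - real r / real k) * extremal_value k t r (card V)"
  shows "\<exists>g. clique_decomposition t r V E (card V div t) (card V mod t) g"
  using assms(4-7)
proof (induction "card V" arbitrary: V rule: less_induct)
  case less
  show ?case
  proof (cases "\<forall>v\<in>V. z v = 0")
    case True
    \<comment> \<open>An extremal value of 0 means that \<open>V\<close> has fewer than
      \<open>r\<close> vertices, so \<open>V\<close> itself is the remainder and no clique condition
      applies to it.\<close>
    then have "extremal_value k t r (card V) = 0"
      using objective_zero[of r k "Graph V E" z t] less.prems(4) assms(1-3) by simp
    then have "card V div t = 0" "\<gamma> k t r (card V mod t) = 0"
      using gamma_nonneg[of k t r "card V mod t"] assms(1,2)
      by (auto simp: extremal_value_def add_nonneg_eq_0_iff)
    then have "card V div t = 0" "card V mod t < r"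
      using gamma_pos[of r "card V mod t" t k] assms(1,2) by force+
    moreover from this have "card V mod t = card V"
      using div_mult_mod_eq[of "card V" t] by simp
    ultimately show ?thesis
      by (intro exI[of _ "\<lambda>_. V"]) (auto simp: clique_decomposition_def disjoint_family_on_def)
  next
    case False
    then obtain v where v: "v \<in> V" "0 < z v" using less.prems(3) by force
    define N where "N = closed_nbhd V E v"
    have "\<forall>v\<in>V. card (closed_nbhd V E v) \<le> t" "\<forall>v\<in>V. 0 \<le> z v"
      using less.prems(2,3) by auto
    note facts = objective_eq_extremal_value[OF assms(1-3) less.prems(1) this less.prems(4) v, folded N_def]
    have N: "N \<subseteq> V" "v \<in> N" using closed_nbhd_subset[OF v(1)] by (auto simp: N_def closed_nbhd_def)
    then have finN: "finite N" using less.prems(1) finite_subset by blast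
    have cards: "card V = card N + card (V - N)"
      using less.prems(1) N(1) finN by (simp add: card_Diff_subset card_mono)
    let ?b = "card (V - N) div t" and ?p = "card (V - N) mod t"
    have "card (V - N) < card V"
      using less.prems(1) N v(1) by (intro psubset_card_mono) auto
    then obtain g where g: "clique_decomposition t r (V - N) E ?b ?p g"
      using less.hyps[of "V - N"] less.prems(1,3) card_closed_nbhd_Diff[OF less.prems(1,2)] facts(5)
      by auto
    have gV: "g i \<subseteq> V - N" if "i \<le> ?b" for i
      using g that by (auto simp: clique_decomposition_def)
    have apart: "{x, y} \<notin> E" "{y, x} \<notin> E" if "x \<in> N" "y \<in> g i" "i \<le> ?b" for x y i
      using facts(2)[OF that(1), of y] gV[OF that(3)] that(2) by (auto simp: insert_commute)
    show ?thesis
    proof (cases "card N = t")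
      case True
      \<comment> \<open>A component of order \<open>t\<close> becomes part 0 and shifts the other
        parts; the remainder keeps its order.\<close>
      have "card V div t = Suc ?b" "card V mod t = ?p"
        using cards True assms(1,2) by auto
      moreover have "clique_decomposition t r V E (Suc ?b) ?p (case_nat N g)"
        unfolding clique_decomposition_def
      proof (intro conjI)
        show "\<Union> (case_nat N g ` {..Suc ?b}) = V"
          using g N(1) by (auto simp: clique_decomposition_def atMost_Suc_eq_insert_0 image_image)
        show "disjoint_family_on (case_nat N g) {..Suc ?b}"
          using g gV by (auto simp: clique_decomposition_def disjoint_family_on_def atMost_Suc_eq_insert_0)
        show "\<forall>i<Suc ?b. card (case_nat N g i) = t \<and> clique (case_nat N g i) E"
          using g True facts(1) by (auto simp: clique_decomposition_def split: nat.split)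
        show "card (case_nat N g (Suc ?b)) = ?p" "r \<le> ?p \<longrightarrow> clique (case_nat N g (Suc ?b)) E"
          using g by (auto simp: clique_decomposition_def)
        show "\<forall>i\<le>Suc ?b. \<forall>j\<le>Suc ?b. i \<noteq> j \<longrightarrow>
            (\<forall>x\<in>case_nat N g i. \<forall>y\<in>case_nat N g j. {x, y} \<notin> E)"
          using g apart by (auto simp: clique_decomposition_def split: nat.split)
      qed
      ultimately show ?thesis by auto
    next
      case False
      \<comment> \<open>A smaller component can only occur when the rest has order divisible by
        \<open>t\<close>. The remainder of the rest is then empty, and \<open>N\<close> takes its
        place.\<close>
      then have p: "?p = 0" and lt: "card N < t"
        using facts(4) less.prems(2)[OF v(1)] by (auto simp: N_def)
      have "finite (g ?b)" using gV[of ?b] less.prems(1) by (auto intro: finite_subset)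
      then have gb: "g ?b = {}" using g p by (simp add: clique_decomposition_def)
      have "card V = card N + ?b * t" using cards p by (metis add.right_neutral div_mult_mod_eq)
      then have "card V div t = ?b" "card V mod t = card N"
        using lt by auto
      moreover have "clique_decomposition t r V E ?b (card N) (g(?b := N))"
        unfolding clique_decomposition_def
      proof (intro conjI)
        have "(\<Union>i\<in>{..?b}. (g(?b := N)) i) = N \<union> (\<Union>i\<in>{..?b}. g i)"
          using gb by (auto split: if_splits)
        then show "\<Union> (g(?b := N) ` {..?b}) = V"
          using g N(1) by (auto simp: clique_decomposition_def)
        show "disjoint_family_on (g(?b := N)) {..?b}"
          using g gV by (fastforce simp: clique_decomposition_def disjoint_family_on_def)
        show "\<forall>i<?b. card ((g(?b := N)) i) = t \<and> clique ((g(?b := N)) i) E"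
          using g by (auto simp: clique_decomposition_def)
        show "card ((g(?b := N)) ?b) = card N" "r \<le> card N \<longrightarrow> clique ((g(?b := N)) ?b) E"
          using facts(1) by auto
        show "\<forall>i\<le>?b. \<forall>j\<le>?b. i \<noteq> j \<longrightarrow> (\<forall>x\<in>(g(?b := N)) i. \<forall>y\<in>(g(?b := N)) j. {x, y} \<notin> E)"
          using g apart by (auto simp: clique_decomposition_def)
      qed
      ultimately show ?thesis by auto
    qed
  qed
qed

text \<open>Each part receives the constant weight optimal for a complete graph of its order. For
  \<open>p < r\<close> this weight is 0 on the remainder, so its edges may be arbitrary. Only a
  lower bound is needed, hence it suffices to count cliques inside single parts.\<close>

lemma clique_decomposition_objective:
  assumes "3 \<le> r" "r \<le> t" "r < k" "finite V"
    and g: "clique_decomposition t r V E b p g"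
  shows "\<exists>z. (\<forall>v\<in>V. 0 \<le> z v) \<and>
    (1 - real r / real k) * (real (b * t) + \<gamma> k t r p) \<le> objective k t r (Graph V E) z"
proof -
  define z where "z v = (if v \<in> g b then full_weight k t r p else full_weight k t r t)" for v
  have z0: "0 \<le> z v" for v by (simp add: z_def full_weight_def)
  have cover: "(\<Union>i\<le>b. g i) = V" and disj: "disjoint_family_on g {..b}"
    and full: "\<And>i. i < b \<Longrightarrow> card (g i) = t \<and> clique (g i) E" and gb: "card (g b) = p" "r \<le> p \<longrightarrow> clique (g b) E"
    using g by (auto simp: clique_decomposition_def)
  have fin: "finite (g i)" if "i \<le> b" for i
    using assms(4) cover that by (auto intro: finite_subset)
  have "full_objective k t r (g b) z = (1 - real r / real k) * \<gamma> k t r p"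
    using assms(1-3) gb(1) fin[of b] by (subst full_objective_const) (auto simp: z_def)
  moreover have "(\<Sum>i<b. full_objective k t r (g i) z) = (\<Sum>i<b. (1 - real r / real k) * real t)"
  proof (rule sum.cong[OF refl])
    fix i assume "i \<in> {..<b}"
    then have "i < b" by simp
    have "x \<notin> g b" if "x \<in> g i" for x
      using disjoint_family_onD[OF disj, of i b] \<open>i < b\<close> that by auto
    then show "full_objective k t r (g i) z = (1 - real r / real k) * real t"
      using assms(1-3) full[OF \<open>i < b\<close>] fin[of i] \<open>i < b\<close>
      by (subst full_objective_const) (auto simp: z_def gamma_full)
  qed
  ultimately have "(\<Sum>i\<le>b. full_objective k t r (g i) z)
      = (1 - real r / real k) * (real (b * t) + \<gamma> k t r p)"
    by (simp only: lessThan_Suc_atMost[symmetric] sum.lessThan_Suc) (simp add: distrib_left)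
  moreover have "(\<Sum>i\<le>b. full_objective k t r (g i) z) \<le> objective k t r (Graph V E) z"
  proof -
    have "(\<Sum>v\<in>V. z v ^ k) = (\<Sum>i\<le>b. \<Sum>v\<in>g i. z v ^ k)"
      unfolding cover[symmetric] using fin disj
      by (intro sum.UNION_disjoint) (auto simp: disjoint_family_on_def)
    moreover have "(\<Sum>i\<le>b. \<Sum>A\<in>[g i]\<^bsup>r\<^esup>. \<Prod>v\<in>A. z v) \<le> clique_sum r (Graph V E) z"
    proof -
      have "[g i]\<^bsup>r\<^esup> \<inter> [g j]\<^bsup>r\<^esup> = {}" if "i \<le> b" "j \<le> b" "i \<noteq> j" for i j
      proof (rule equals0I)
        fix A assume "A \<in> [g i]\<^bsup>r\<^esup> \<inter> [g j]\<^bsup>r\<^esup>"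
        then have "A \<subseteq> g i \<inter> g j" "card A = r" by (auto simp: nsets_def)
        moreover have "g i \<inter> g j = {}" using disjoint_family_onD[OF disj, of i j] that by simp
        ultimately show False using assms(1) by simp
      qed
      moreover have "finite ([g i]\<^bsup>r\<^esup>)" if "i \<le> b" for i
        using fin[OF that] by (rule finite_imp_finite_nsets)
      ultimately have "(\<Sum>i\<le>b. \<Sum>A\<in>[g i]\<^bsup>r\<^esup>. \<Prod>v\<in>A. z v) = (\<Sum>A\<in>(\<Union>i\<le>b. [g i]\<^bsup>r\<^esup>). \<Prod>v\<in>A. z v)"
        by (intro sum.UNION_disjoint[symmetric]) simp_all
      also have "\<dots> \<le> clique_sum r (Graph V E) z"
        unfolding clique_sum_def
      proof (rule sum_mono2)
        show "finite (cliques r (Graph V E))"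
          using assms(4) by (simp add: cliques_Graph finite_imp_finite_nsets)
        show "(\<Union>i\<le>b. [g i]\<^bsup>r\<^esup>) \<subseteq> cliques r (Graph V E)"
        proof
          fix A assume "A \<in> (\<Union>i\<le>b. [g i]\<^bsup>r\<^esup>)"
          then obtain i where i: "i \<le> b" "A \<in> [g i]\<^bsup>r\<^esup>" by auto
          \<comment> \<open>An \<open>r\<close>-subset of the last part exists only if
            \<open>r <= p\<close>, and then that part is a clique by assumption.\<close>
          have "r \<le> card (g i)" using i(2) fin[OF i(1)] by (auto simp: nsets_def card_mono)
          then have "clique (g i) E" using full[of i] gb i(1) by (cases "i = b") auto
          moreover have "g i \<subseteq> V" using cover i(1) by auto
          ultimately show "A \<in> cliques r (Graph V E)"
            using i(2) by (auto simp: cliques_Graph nsets_def intro: smaller_clique)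
        qed
      qed (use z0 in \<open>auto intro: prod_nonneg\<close>)
      finally show ?thesis .
    qed
    ultimately show ?thesis
      by (simp only: objective_def full_objective_def sum_subtractf ugraph.sel flip: sum_distrib_left)
        (simp add: mult_left_mono divide_right_mono)
  qed
  ultimately show ?thesis using z0 by auto
qed

section \<open>Isomorphism with the extremal graphs\<close>

lemma edges_disj_union_iff:
  "d \<in> edges (G \<union>\<^sub>g H) \<longleftrightarrow> (\<exists>e\<in>edges G. d = Inl ` e) \<or> (\<exists>e\<in>edges H. d = Inr ` e)"
  by (simp only: disj_union_def ugraph.sel Un_iff image_iff)

lemma Inl_edge_disj_union [simp]: "{Inl x, Inl y} \<in> edges (G \<union>\<^sub>g H) \<longleftrightarrow> {x, y} \<in> edges G"
proof -
  have "{Inl x, Inl y} = Inl ` e \<longleftrightarrow> e = {x, y}" for e :: "'a set"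
    using inj_image_eq_iff[OF inj_Inl, of "{x, y}" e] by (auto simp only: image_insert image_empty)
  moreover have "{Inl x, Inl y} \<noteq> Inr ` e" for e :: "'b set"
    by (metis Inl_Inr_False imageE insertI1)
  ultimately show ?thesis unfolding edges_disj_union_iff by metis
qed

lemma Inr_edge_disj_union [simp]: "{Inr x, Inr y} \<in> edges (G \<union>\<^sub>g H) \<longleftrightarrow> {x, y} \<in> edges H"
proof -
  have "{Inr x, Inr y} = Inr ` e \<longleftrightarrow> e = {x, y}" for e :: "'b set"
    using inj_image_eq_iff[OF inj_Inr, of "{x, y}" e] by (auto simp only: image_insert image_empty)
  moreover have "{Inr x, Inr y} \<noteq> Inl ` e" for e :: "'a set"
    by (metis Inr_Inl_False imageE insertI1)
  ultimately show ?thesis unfolding edges_disj_union_iff by metis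
qed

lemma Inl_Inr_edge_disj_union [simp]:
  "{Inl x, Inr y} \<notin> edges (G \<union>\<^sub>g H)" "{Inr y, Inl x} \<notin> edges (G \<union>\<^sub>g H)"
proof -
  have "{Inl x, Inr y} \<noteq> Inl ` d" "{Inl x, Inr y} \<noteq> Inr ` e" for d :: "'a set" and e :: "'b set"
    by (metis Inr_Inl_False imageE insertI1 insertI2, metis Inl_Inr_False imageE insertI1)
  then show "{Inl x, Inr y} \<notin> edges (G \<union>\<^sub>g H)"
    unfolding edges_disj_union_iff by metis
  then show "{Inr y, Inl x} \<notin> edges (G \<union>\<^sub>g H)"
    by (subst insert_commute)
qed

lemma edge_copies [simp]:
  "{(i, x), (j, y)} \<in> edges (copies b G) \<longleftrightarrow> i = j \<and> i < b \<and> {x, y} \<in> edges G"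
proof
  assume "{(i, x), (j, y)} \<in> edges (copies b G)"
  then obtain l e where e: "{(i, x), (j, y)} = Pair l ` e" "l < b" "e \<in> edges G"
    by (auto simp: copies_def)
  have "(i, x) \<in> Pair l ` e" "(j, y) \<in> Pair l ` e" by (simp_all flip: e(1))
  then have "i = l" "j = l" by auto
  moreover have "{x, y} = e" using arg_cong[OF e(1), of "image snd"] by (simp add: image_image)
  ultimately show "i = j \<and> i < b \<and> {x, y} \<in> edges G" using e(2,3) by auto
next
  assume "i = j \<and> i < b \<and> {x, y} \<in> edges G"
  then show "{(i, x), (j, y)} \<in> edges (copies b G)"
    unfolding copies_def ugraph.sel by (intro CollectI exI[of _ i] exI[of _ "{x, y}"]) simp
qed

lemma edge_complete_graph [simp]: "{x, y} \<in> edges (complete_graph n) \<longleftrightarrow> x < n \<and> y < n \<and> x \<noteq> y"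
  by (simp add: complete_graph_def)

lemma verts_extremal [simp]:
  "verts (G \<union>\<^sub>g H) = verts G <+> verts H" "verts (copies b G) = {..<b} \<times> verts G"
  "verts (complete_graph n) = {..<n}"
  by (simp_all add: disj_union_def copies_def complete_graph_def)

text \<open>Each part is numbered by a bijection \<open>h i\<close> onto an initial segment of the
  naturals. The remainder graph is the image of the last part under \<open>h b\<close>; if that part
  is a clique, the image is literally \<open>complete_graph p\<close>.\<close>

lemma clique_decomposition_imp_iso:
  fixes F :: "'a ugraph"
  assumes F: "simple_graph F" and g: "clique_decomposition t r (verts F) (edges F) b p g"
  shows "\<exists>F\<^sub>0 :: nat ugraph. simple_graph F\<^sub>0 \<and> card (verts F\<^sub>0) = p \<and> (r \<le> p \<longrightarrow> F\<^sub>0 = complete_graph p)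
    \<and> F \<cong>\<^sub>g copies b (complete_graph t) \<union>\<^sub>g F\<^sub>0"
proof -
  have cover: "(\<Union>i\<le>b. g i) = verts F" and disj: "disjoint_family_on g {..b}"
    and full: "\<And>i. i < b \<Longrightarrow> card (g i) = t \<and> clique (g i) (edges F)"
    and gb: "card (g b) = p" "r \<le> p \<Longrightarrow> clique (g b) (edges F)"
    and apart: "\<And>i j x y. i \<le> b \<Longrightarrow> j \<le> b \<Longrightarrow> i \<noteq> j \<Longrightarrow> x \<in> g i \<Longrightarrow> y \<in> g j \<Longrightarrow> {x, y} \<notin> edges F"
    using g by (auto simp: clique_decomposition_def)
  have noloop: "{x, x} \<notin> edges F" for x
    using F by (auto simp: simple_graph_def nsets_def)
  have fin: "finite (g i)" if "i \<le> b" for i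
    using F cover that by (auto simp: simple_graph_def intro: finite_subset)
  have "\<exists>h. bij_betw h (g i) {..<card (g i)}" if "i \<le> b" for i
    using ex_bij_betw_finite_nat[OF fin[OF that]] by (simp add: atLeast0LessThan)
  then obtain h where h: "\<And>i. i \<le> b \<Longrightarrow> bij_betw (h i) (g i) {..<card (g i)}" by metis
  have hinj: "h i x = h i y \<longleftrightarrow> x = y" if "i \<le> b" "x \<in> g i" "y \<in> g i" for i x y
    using bij_betw_imp_inj_on[OF h[OF that(1)]] that by (auto dest: inj_onD)
  have hlt: "h i x < card (g i)" if "i \<le> b" "x \<in> g i" for i x
    using bij_betwE[OF h[OF that(1)]] that by auto
  define idx where "idx x = (THE i. i \<le> b \<and> x \<in> g i)" for x
  have idx: "idx x = i" if "i \<le> b" "x \<in> g i" for i x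
    unfolding idx_def using that disjoint_family_onD[OF disj] by (intro the_equality) auto
  have part: "\<exists>i\<le>b. x \<in> g i" if "x \<in> verts F" for x using that cover by auto
  \<comment> \<open>By disjointness \<open>idx x\<close> is the unique part containing
    \<open>x\<close>; it selects the copy, and index \<open>b\<close> selects the remainder.\<close>
  define f where "f x = (if idx x = b then Inr (h b x) else Inl (idx x, h (idx x) x))" for x
  have fb: "f x = Inr (h b x)" if "x \<in> g b" for x
    using idx[OF _ that] by (simp add: f_def)
  have fi: "f x = Inl (i, h i x)" if "i < b" "x \<in> g i" for i x
    using idx[of i x] that by (simp add: f_def)
  define F\<^sub>0 where "F\<^sub>0 = Graph {..<p} {{h b x, h b y} | x y. x \<in> g b \<and> y \<in> g b \<and> {x, y} \<in> edges F}"
  have edge0: "{h b x, h b y} \<in> edges F\<^sub>0 \<longleftrightarrow> {x, y} \<in> edges F" if "x \<in> g b" "y \<in> g b" for x y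
    using that hinj[of b] by (auto simp: F\<^sub>0_def doubleton_eq_iff insert_commute)
  have "simple_graph F\<^sub>0"
    using hlt[of b] gb(1) hinj[of b] noloop by (auto simp: simple_graph_def F\<^sub>0_def)
  moreover have "F\<^sub>0 = complete_graph p" if "r \<le> p"
  proof -
    have "{a, c} \<in> edges F\<^sub>0" if ac: "a < p" "c < p" "a \<noteq> c" for a c
    proof -
      obtain x y where "x \<in> g b" "y \<in> g b" "a = h b x" "c = h b y"
        using bij_betw_imp_surj_on[OF h[of b]] gb(1) ac by (metis imageE lessThan_iff order_refl)
      then show ?thesis using edge0 gb(2)[OF \<open>r \<le> p\<close>] ac(3) by (auto simp: clique_def)
    qed
    then have "[{..<p}]\<^bsup>2\<^esup> \<subseteq> edges F\<^sub>0" by (auto simp: nsets_2_eq)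
    moreover have "edges F\<^sub>0 \<subseteq> [{..<p}]\<^bsup>2\<^esup>" using \<open>simple_graph F\<^sub>0\<close> by (simp add: simple_graph_def F\<^sub>0_def)
    ultimately show ?thesis by (simp add: F\<^sub>0_def complete_graph_def)
  qed
  moreover have "F \<cong>\<^sub>g copies b (complete_graph t) \<union>\<^sub>g F\<^sub>0"
    unfolding graph_iso_def
  proof (intro exI[of _ f] conjI ballI)
    show "bij_betw f (verts F) (verts (copies b (complete_graph t) \<union>\<^sub>g F\<^sub>0))"
    proof (rule bij_betw_imageI)
      show "inj_on f (verts F)"
      proof (rule inj_onI)
        fix x y assume xy: "x \<in> verts F" "y \<in> verts F" "f x = f y"
        obtain i j where i: "i \<le> b" "x \<in> g i" and j: "j \<le> b" "y \<in> g j" using part xy by metis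
        show "x = y"
          using xy(3) i j fb fi hinj by (cases "i = b"; cases "j = b") (auto simp: le_less)
      qed
      show "f ` verts F = verts (copies b (complete_graph t) \<union>\<^sub>g F\<^sub>0)"
      proof
        show "f ` verts F \<subseteq> verts (copies b (complete_graph t) \<union>\<^sub>g F\<^sub>0)"
        proof (rule image_subsetI)
          fix x assume "x \<in> verts F"
          then obtain i where i: "i \<le> b" "x \<in> g i" using part by metis
          then show "f x \<in> verts (copies b (complete_graph t) \<union>\<^sub>g F\<^sub>0)"
          proof (cases "i = b")
            case True
            then show ?thesis using fb hlt[OF i] gb(1) i by (auto simp: F\<^sub>0_def)
          next
            case False
            then have "i < b" using i by simp
            then show ?thesis using fi hlt[OF i] full i by auto
          qed
        qed
        show "verts (copies b (complete_graph t) \<union>\<^sub>g F\<^sub>0) \<subseteq> f ` verts F"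
        proof
          fix q assume q: "q \<in> verts (copies b (complete_graph t) \<union>\<^sub>g F\<^sub>0)"
          show "q \<in> f ` verts F"
          proof (cases q)
            case (Inl ia)
            obtain i a where ia: "ia = (i, a)" by (cases ia)
            then have "i < b" "a < t" using q Inl by auto
            then obtain x where "x \<in> g i" "a = h i x"
              using bij_betw_imp_surj_on[OF h[of i]] full[of i] by (metis imageE lessThan_iff less_imp_le)
            then show ?thesis using fi[OF \<open>i < b\<close>] Inl ia cover \<open>i < b\<close> by (auto intro!: image_eqI[of _ _ x])
          next
            case (Inr a)
            then have "a < p" using q by (auto simp: F\<^sub>0_def)
            then obtain x where "x \<in> g b" "a = h b x"
              using bij_betw_imp_surj_on[OF h[of b]] gb(1) by (metis imageE lessThan_iff order_refl)
            then show ?thesis using fb Inr cover by (auto intro!: image_eqI[of _ _ x])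
          qed
        qed
      qed
    qed
  next
    fix x y assume xy: "x \<in> verts F" "y \<in> verts F"
    obtain i j where i: "i \<le> b" "x \<in> g i" and j: "j \<le> b" "y \<in> g j" using part xy by metis
    show "{x, y} \<in> edges F \<longleftrightarrow> {f x, f y} \<in> edges (copies b (complete_graph t) \<union>\<^sub>g F\<^sub>0)"
    proof (cases "i = j")
      case False
      then show ?thesis
        using i j fb fi apart[OF i(1) j(1) False i(2) j(2)] by (cases "i = b"; cases "j = b") (auto simp: le_less)
    next
      case same: True
      show ?thesis
      proof (cases "i = b")
        case True
        then show ?thesis using same i j by (simp add: fb edge0)
      next
        case False
        then have "i < b" using i by simp
        then have "{x, y} \<in> edges F \<longleftrightarrow> x \<noteq> y"
          using full i j same noloop by (auto simp: clique_def)
        then show ?thesis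
          using \<open>i < b\<close> i j same fi hinj[OF i j(2)[folded same]] hlt[OF i] hlt[OF j] full by simp
      qed
    qed
  qed
  moreover have "card (verts F\<^sub>0) = p" by (simp add: F\<^sub>0_def)
  ultimately show ?thesis by blast
qed

text \<open>The parts are the preimages, under the isomorphism, of the copies and of the
  remainder.\<close>

lemma iso_imp_clique_decomposition:
  fixes F :: "'a ugraph" and F\<^sub>0 :: "'b ugraph"
  assumes iso: "F \<cong>\<^sub>g copies b (complete_graph t) \<union>\<^sub>g F\<^sub>0" and p: "card (verts F\<^sub>0) = p"
    and full: "r \<le> p \<Longrightarrow> clique (verts F\<^sub>0) (edges F\<^sub>0)"
  shows "\<exists>g. clique_decomposition t r (verts F) (edges F) b p g"
proof -
  obtain f where f: "bij_betw f (verts F) (({..<b} \<times> {..<t}) <+> verts F\<^sub>0)"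
    and edge: "\<And>u v. u \<in> verts F \<Longrightarrow> v \<in> verts F \<Longrightarrow>
      {u, v} \<in> edges F \<longleftrightarrow> {f u, f v} \<in> edges (copies b (complete_graph t) \<union>\<^sub>g F\<^sub>0)"
    using iso unfolding graph_iso_def by auto
  define P where "P i = (if i < b then Inl ` ({i} \<times> {..<t}) else Inr ` verts F\<^sub>0)" for i
  define g where "g i = {x \<in> verts F. f x \<in> P i}" for i
  have P: "P i \<subseteq> ({..<b} \<times> {..<t}) <+> verts F\<^sub>0" for i by (auto simp: P_def)
  have "f ` g i = P i" for i
  proof
    show "P i \<subseteq> f ` g i"
    proof
      fix q assume "q \<in> P i"
      moreover from this obtain x where "x \<in> verts F" "q = f x"
        using P[of i] bij_betw_imp_surj_on[OF f] by blast
      ultimately show "q \<in> f ` g i" by (auto simp: g_def)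
    qed
  qed (auto simp: g_def)
  then have card: "card (g i) = card (P i)" for i
    using bij_betw_imp_inj_on[OF f] card_image[of f "g i"] by (metis (no_types, lifting) g_def inj_on_subset mem_Collect_eq subsetI)
  have cases: "(\<exists>i a. i < b \<and> a < t \<and> f x = Inl (i, a)) \<or> (\<exists>c\<in>verts F\<^sub>0. f x = Inr c)" if "x \<in> verts F" for x
    using bij_betwE[OF f] that by fastforce
  have inj: "f x = f y \<longleftrightarrow> x = y" if "x \<in> verts F" "y \<in> verts F" for x y
    using bij_betw_imp_inj_on[OF f] that by (auto dest: inj_onD)
  have "clique_decomposition t r (verts F) (edges F) b p g"
    unfolding clique_decomposition_def
  proof (intro conjI allI impI ballI)
    show "\<Union> (g ` {..b}) = verts F"
    proof
      show "verts F \<subseteq> \<Union> (g ` {..b})"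
      proof
        fix x assume x: "x \<in> verts F"
        from cases[OF x] have "\<exists>i\<le>b. f x \<in> P i"
        proof (elim disjE exE conjE bexE)
          fix i a assume "i < b" "a < t" "f x = Inl (i, a)"
          then show ?thesis by (intro exI[of _ i]) (simp add: P_def)
        qed (intro exI[of _ b], simp add: P_def)
        then show "x \<in> \<Union> (g ` {..b})" using x by (auto simp: g_def)
      qed
    qed (auto simp: g_def)
    show "disjoint_family_on g {..b}"
      by (auto simp: disjoint_family_on_def g_def P_def split: if_splits)
    show "card (g i) = t" if "i < b" for i
      using that by (simp add: card P_def card_image)
    show "clique (g i) (edges F)" if i: "i < b" for i
      unfolding clique_def
    proof (intro ballI impI)
      fix x y assume xy: "x \<in> g i" "y \<in> g i" "x \<noteq> y"
      then obtain a c where "f x = Inl (i, a)" "f y = Inl (i, c)" "a < t" "c < t"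
        using i by (auto simp: g_def P_def)
      moreover from this have "a \<noteq> c" using inj[of x y] xy by (auto simp: g_def)
      ultimately show "{x, y} \<in> edges F" using edge[of x y] xy that by (simp add: g_def)
    qed
    show "card (g b) = p" by (simp add: card P_def card_image p)
    show "clique (g b) (edges F)" if "r \<le> p"
      unfolding clique_def
    proof (intro ballI impI)
      fix x y assume xy: "x \<in> g b" "y \<in> g b" "x \<noteq> y"
      then obtain a c where "f x = Inr a" "f y = Inr c" "a \<in> verts F\<^sub>0" "c \<in> verts F\<^sub>0"
        by (auto simp: g_def P_def)
      moreover from this have "a \<noteq> c" using inj[of x y] xy by (auto simp: g_def)
      ultimately show "{x, y} \<in> edges F"
        using edge[of x y] xy full[OF that] by (simp add: g_def clique_def)
    qed
    show "{x, y} \<notin> edges F" if "i \<le> b" "j \<le> b" "i \<noteq> j" "x \<in> g i" "y \<in> g j" for i j x y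
      using edge[of x y] that by (auto simp: g_def P_def split: if_splits)
  qed
  then show ?thesis by blast
qed

section \<open>From the unconstrained problem back to the capacity\<close>

lemma card_closed_nbhd_le:
  assumes F: "simple_graph F" and "max_degree F \<le> t - 1" "0 < t" and v: "v \<in> verts F"
  shows "card (closed_nbhd (verts F) (edges F) v) \<le> t"
proof -
  have "degree F v \<le> max_degree F"
    using F v by (simp add: max_degree_def simple_graph_def)
  moreover have "card (closed_nbhd (verts F) (edges F) v) = Suc (degree F v)"
    unfolding closed_nbhd_def degree_def using F
    by (subst card_insert_disjoint) (auto simp: simple_graph_def nsets_def)
  ultimately show ?thesis using assms by simp
qed

text \<open>A maximiser \<open>z\<close> from \<open>capacity_attained\<close> carries the upper
  bound, and in the case of equality it is the vector required by
  \<open>clique_decomposition_exists\<close>. Conversely, the test vector of a decomposition bounds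
  the capacity from below through \<open>objective_le_capacity\<close>.\<close>

lemma capacity_extremal:
  assumes "3 \<le> r" "r \<le> t" "r < k" and F: "simple_graph F" "max_degree F \<le> t - 1"
  defines "h \<equiv> card (verts F)"
  shows "capacity k t r F \<le> extremal_value k t r h"
    and "capacity k t r F = extremal_value k t r h
      \<longleftrightarrow> (\<exists>g. clique_decomposition t r (verts F) (edges F) (h div t) (h mod t) g)"
proof -
  let ?\<kappa> = "1 - real r / real k"
  have \<kappa>: "0 < ?\<kappa>" using assms(3) by simp
  have fin: "finite (verts F)" using F by (simp add: simple_graph_def)
  have deg: "card (closed_nbhd (verts F) (edges F) v) \<le> t" if "v \<in> verts F" for v
    using card_closed_nbhd_le[OF F _ that] assms by simp
  have r: "0 < r" using assms by simp
  obtain z where z: "\<And>v. v \<in> verts F \<Longrightarrow> 0 \<le> z v" "objective k t r F z = ?\<kappa> * capacity k t r F"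
    using capacity_attained[OF r assms(2,3) fin] by blast
  have "?\<kappa> * capacity k t r F \<le> ?\<kappa> * extremal_value k t r h"
    using objective_le_extremal_value[OF assms(1-3) fin deg, of z] z by (simp add: h_def)
  then show le: "capacity k t r F \<le> extremal_value k t r h"
    using \<kappa> by (simp only: mult_le_cancel_left_pos)
  show "capacity k t r F = extremal_value k t r h
      \<longleftrightarrow> (\<exists>g. clique_decomposition t r (verts F) (edges F) (h div t) (h mod t) g)"
  proof
    assume "capacity k t r F = extremal_value k t r h"
    then have "objective k t r (Graph (verts F) (edges F)) z = ?\<kappa> * extremal_value k t r (card (verts F))"
      using z(2) by (simp add: h_def)
    then show "\<exists>g. clique_decomposition t r (verts F) (edges F) (h div t) (h mod t) g"
      unfolding h_def using z(1) by (intro clique_decomposition_exists[OF assms(1-3) fin deg])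
  next
    assume "\<exists>g. clique_decomposition t r (verts F) (edges F) (h div t) (h mod t) g"
    then obtain g where "clique_decomposition t r (verts F) (edges F) (h div t) (h mod t) g" ..
    from clique_decomposition_objective[OF assms(1-3) fin this]
    obtain y where y: "\<And>v. v \<in> verts F \<Longrightarrow> 0 \<le> y v"
      "?\<kappa> * extremal_value k t r h \<le> objective k t r F y"
      by (auto simp: extremal_value_def)
    have "?\<kappa> * extremal_value k t r h \<le> ?\<kappa> * capacity k t r F"
      using y(2) objective_le_capacity[OF r assms(2,3) fin, of y] y(1) by force
    then have "extremal_value k t r h \<le> capacity k t r F"
      using \<kappa> by (simp only: mult_le_cancel_left_pos)
    then show "capacity k t r F = extremal_value k t r h" using le by simp
  qed
qed

theorem theorem6p5:
  fixes F :: "'a ugraph" and r t k h b p :: nat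
  assumes "3 \<le> r" and "r \<le> t" and "r < k"
    and "h = b * t + p" and "p < t"
    and "simple_graph F" and "card (verts F) = h" and "max_degree F \<le> t - 1"
  shows "capacity k t r F \<le> real (b * t) + \<gamma> k t r p
    \<and> (r \<le> p \<longrightarrow>
        (capacity k t r F = real (b * t) + \<gamma> k t r p
          \<longleftrightarrow> F \<cong>\<^sub>g copies b (complete_graph t) \<union>\<^sub>g complete_graph p))
    \<and> (p < r \<longrightarrow>
        (capacity k t r F = real (b * t) + \<gamma> k t r p
          \<longleftrightarrow> (\<exists>F\<^sub>0 :: nat ugraph. simple_graph F\<^sub>0 \<and> card (verts F\<^sub>0) = p \<and>
                F \<cong>\<^sub>g copies b (complete_graph t) \<union>\<^sub>g F\<^sub>0)))"
proof -
  have divmod: "h div t = b" "h mod t = p" using assms by auto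
  have extremal: "extremal_value k t r h = real (b * t) + \<gamma> k t r p"
    by (simp add: extremal_value_def divmod)
  note cap = capacity_extremal[OF assms(1-3,6,8), unfolded assms(7) divmod extremal]
  have "clique {..<p} (edges (complete_graph p))" by (simp add: clique_def)
  then have "\<exists>g. clique_decomposition t r (verts F) (edges F) b p g"
    if "F \<cong>\<^sub>g copies b (complete_graph t) \<union>\<^sub>g complete_graph p"
    using iso_imp_clique_decomposition[OF that, of p r] by simp
  \<comment> \<open>The two forms of the equality statement differ only in the last part: for
    \<open>r <= p\<close> the decomposition makes it a clique, and for \<open>p < r\<close> it
    leaves it arbitrary.\<close>
  then have "(\<exists>g. clique_decomposition t r (verts F) (edges F) b p g)
      \<longleftrightarrow> F \<cong>\<^sub>g copies b (complete_graph t) \<union>\<^sub>g complete_graph p" if "r \<le> p"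
    using clique_decomposition_imp_iso[OF assms(6)] that by metis
  moreover have "(\<exists>g. clique_decomposition t r (verts F) (edges F) b p g)
      \<longleftrightarrow> (\<exists>F\<^sub>0 :: nat ugraph. simple_graph F\<^sub>0 \<and> card (verts F\<^sub>0) = p \<and>
            F \<cong>\<^sub>g copies b (complete_graph t) \<union>\<^sub>g F\<^sub>0)" if "p < r"
    using clique_decomposition_imp_iso[OF assms(6)] iso_imp_clique_decomposition[of F b t _ p r] that
    by (metis not_le)
  ultimately show ?thesis using cap by blast
qed

end
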